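(* Let $s\in\{s_1,\dots,s_m\}$ be an interior knot of $p_0$. Then there exists a unique minimizer of $$\Phi^{\le s}(g)=\frac12\sum_{k=0}^s(g(k)-\mathbb W(k))^2$$ over $\mathcal C^{\le s}(\mathcal K)$, the set of vectors $g=(g(0),\dots,g(s))\in\mathbb R^{s+1}$ that are convex on $\{s_j,\dots,s_{j+1}\}$ for every $j\in\{0,\dots,m\}$ with $s_{j+1}\le s$. This minimizer equals $(\hat g(0),\dots,\hat g(s))$ if and only if $\widehat{\mathbb G}(s)=\mathbb U(F_{p_0}(s))$. Moreover, $\sqrt n\big(\hat p_n(0)-p_0(0),\dots,\hat p_n(s)-p_0(s)\big)$ converges in distribution to the minimizer of $\Phi^{\le s}$ over $\mathcal C^{\le s}(\mathcal K)$ if and only if $F_{\hat p_n}(s)=F_{p_n}(s)+o_p(n^{-1/2})$.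
   Context: Let $\mathbb N=\{0,1,\dots\}$. For a real sequence $p$ and $k\ge1$ let $\Delta p(k)=p(k+1)-2p(k)+p(k-1)$; $p$ is convex if $\Delta p(k)\ge0$ for all $k\ge1$; $\mathcal C$ is the set of convex sequences with $\sum_kp(k)^2<\infty$. A knot of $p$ is an integer $k\ge1$ with $\Delta p(k)>0$. For a sequence $p$ let $F_p(k)=\sum_{j=0}^kp(j)$ ($F_p(-1)=0$). Let $p_0$ be a convex probability mass function on $\mathbb N$ with finite support $\{0,\dots,S\}$, $S\ge1$. Let $X_1,X_2,\dots$ be i.i.d. with pmf $p_0$, $p_n(j)=\frac1n\sum_{i\le n}\mathbb 1\{X_i=j\}$, and let $\hat p_n$ be the unique minimizer over $\mathcal C$ of $\frac12\sum_j(p_n(j)-p(j))^2$. Let $\mathbb U$ be a standard Brownian bridge on $[0,1]$, $\mathbb W(k)=\mathbb U(F_{p_0}(k))-\mathbb U(F_{p_0}(k-1))$ for $k\in\{0,\dots,S+1\}$. Let $s_1<\dots<s_m$ ($m\ge1$) be the knots of $p_0$ in $\{1,\dots,S\}$, $s_0=0$, $s_{m+1}=S+1$, $\mathcal K=\{s_1,\dots,s_m\}$. A vector $g$ is convex on $\{a,\dots,b\}$ if $g(k+1)-2g(k)+g(k-1)\ge0$ for $a<k<b$; $\mathcal C(\mathcal K)$ is the set of $g\in\mathbb R^{S+2}$ (indexed $0,\dots,S+1$) convex on $\{s_j,\dots,s_{j+1}\}$ for all $j=0,\dots,m$. Let $\hat g$ be the unique minimizer over $\mathcal C(\mathcal K)$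 of $\frac12\sum_{k=0}^{S+1}(g(k)-\mathbb W(k))^2$, and $\widehat{\mathbb G}(x)=\sum_{k=0}^x\hat g(k)$. The first two assertions hold for each realization of $\mathbb U$. *)

theory Defs
  imports "HOL-Probability.Probability"
begin

definition Dlt :: "(nat \<Rightarrow> real) \<Rightarrow> nat \<Rightarrow> real" where
  "Dlt p k = p (k + 1) - 2 * p k + p (k - 1)"

definition convex_seq :: "(nat \<Rightarrow> real) \<Rightarrow> bool" where
  "convex_seq p \<longleftrightarrow> (\<forall>k\<ge>1. Dlt p k \<ge> 0)"

definition Cset :: "(nat \<Rightarrow> real) set" where
  "Cset = {p. convex_seq p \<and> summable (\<lambda>k. (p k)^2)}"

definition is_knot :: "(nat \<Rightarrow> real) \<Rightarrow> nat \<Rightarrow> bool" where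
  "is_knot p k \<longleftrightarrow> k \<ge> 1 \<and> Dlt p k > 0"

definition Fseq :: "(nat \<Rightarrow> real) \<Rightarrow> nat \<Rightarrow> real" where
  "Fseq p k = (\<Sum>j\<le>k. p j)"

definition lsq_obj :: "(nat \<Rightarrow> real) \<Rightarrow> (nat \<Rightarrow> real) \<Rightarrow> real" where
  "lsq_obj q p = 1/2 * (\<Sum>j. (q j - p j)^2)"

definition lse :: "(nat \<Rightarrow> real) \<Rightarrow> (nat \<Rightarrow> real)" where
  "lse q = (THE p. p \<in> Cset \<and> (\<forall>p'\<in>Cset. lsq_obj q p \<le> lsq_obj q p'))"

definition emp_pmf :: "(nat \<Rightarrow> 'a \<Rightarrow> nat) \<Rightarrow> nat \<Rightarrow> 'a \<Rightarrow> nat \<Rightarrow> real" where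
  "emp_pmf X n \<omega> j = real (card {i\<in>{1..n}. X i \<omega> = j}) / real n"

definition convex_between :: "(nat \<Rightarrow> real) \<Rightarrow> nat \<Rightarrow> nat \<Rightarrow> bool" where
  "convex_between g a b \<longleftrightarrow> (\<forall>k. a < k \<and> k < b \<longrightarrow> g (k + 1) - 2 * g k + g (k - 1) \<ge> 0)"

text \<open>s_0 = 0, the knots s_1 < ... < s_m of p0 in {1..S}, s_{m+1} = S+1.\<close>
definition breakpoints :: "(nat \<Rightarrow> real) \<Rightarrow> nat \<Rightarrow> nat set" where
  "breakpoints p0 S = {0} \<union> {k. 1 \<le> k \<and> k \<le> S \<and> is_knot p0 k} \<union> {S + 1}"

definition consec :: "nat set \<Rightarrow> nat \<Rightarrow> nat \<Rightarrow> bool" where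
  "consec B a b \<longleftrightarrow> a \<in> B \<and> b \<in> B \<and> a < b \<and> (\<forall>c\<in>B. \<not> (a < c \<and> c < b))"

text \<open>Vectors in R^{n+1}, indexed 0..n, represented as functions vanishing beyond n.\<close>
definition vecs :: "nat \<Rightarrow> (nat \<Rightarrow> real) set" where
  "vecs n = {g. \<forall>k>n. g k = 0}"

definition CK :: "(nat \<Rightarrow> real) \<Rightarrow> nat \<Rightarrow> (nat \<Rightarrow> real) set" where
  "CK p0 S = {g \<in> vecs (S + 1). \<forall>a b. consec (breakpoints p0 S) a b \<longrightarrow> convex_between g a b}"

definition CKle :: "(nat \<Rightarrow> real) \<Rightarrow> nat \<Rightarrow> nat \<Rightarrow> (nat \<Rightarrow> real) set" where
  "CKle p0 S s = {g \<in> vecs s. \<forall>a b. consec (breakpoints p0 S) a b \<and> b \<le> s \<longrightarrow> convex_between g a b}"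

text \<open>W(k) = U(F_{p0}(k)) - U(F_{p0}(k-1)), with F_{p0}(-1) = 0; u is one realization of U.\<close>
definition Wvec :: "(nat \<Rightarrow> real) \<Rightarrow> (real \<Rightarrow> real) \<Rightarrow> nat \<Rightarrow> real" where
  "Wvec p0 u k = u (Fseq p0 k) - (if k = 0 then u 0 else u (Fseq p0 (k - 1)))"

definition Phi_full :: "(nat \<Rightarrow> real) \<Rightarrow> nat \<Rightarrow> (real \<Rightarrow> real) \<Rightarrow> (nat \<Rightarrow> real) \<Rightarrow> real" where
  "Phi_full p0 S u g = 1/2 * (\<Sum>k\<le>S + 1. (g k - Wvec p0 u k)^2)"

definition ghat :: "(nat \<Rightarrow> real) \<Rightarrow> nat \<Rightarrow> (real \<Rightarrow> real) \<Rightarrow> (nat \<Rightarrow> real)" where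
  "ghat p0 S u = (THE g. g \<in> CK p0 S \<and> (\<forall>h\<in>CK p0 S. Phi_full p0 S u g \<le> Phi_full p0 S u h))"

definition Phi_le :: "(nat \<Rightarrow> real) \<Rightarrow> (real \<Rightarrow> real) \<Rightarrow> nat \<Rightarrow> (nat \<Rightarrow> real) \<Rightarrow> real" where
  "Phi_le p0 u s g = 1/2 * (\<Sum>k\<le>s. (g k - Wvec p0 u k)^2)"

definition gle :: "(nat \<Rightarrow> real) \<Rightarrow> nat \<Rightarrow> nat \<Rightarrow> (real \<Rightarrow> real) \<Rightarrow> (nat \<Rightarrow> real)" where
  "gle p0 S s u = (THE g. g \<in> CKle p0 S s \<and> (\<forall>h\<in>CKle p0 S s. Phi_le p0 u s g \<le> Phi_le p0 u s h))"

text \<open>Standard Brownian bridge on [0,1]: continuous paths with U(0)=U(1)=0, and centered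
  Gaussian finite-dimensional distributions with covariance min(s,t) - s t
  (expressed through the joint characteristic functions).\<close>
definition brownian_bridge :: "'b measure \<Rightarrow> ('b \<Rightarrow> real \<Rightarrow> real) \<Rightarrow> bool" where
  "brownian_bridge N U \<longleftrightarrow> prob_space N \<and>
     (\<forall>t\<in>{0..1}. (\<lambda>\<omega>. U \<omega> t) \<in> borel_measurable N) \<and>
     (\<forall>\<omega>\<in>space N. continuous_on {0..1} (U \<omega>) \<and> U \<omega> 0 = 0 \<and> U \<omega> 1 = 0) \<and>
     (\<forall>(n::nat) (t::nat \<Rightarrow> real) (a::nat \<Rightarrow> real). (\<forall>i<n. 0 \<le> t i \<and> t i \<le> 1) \<longrightarrow>
        (\<integral>\<omega>. cis (\<Sum>i<n. a i * U \<omega> (t i)) \<partial>N) =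
          complex_of_real (exp (- (1/2) * (\<Sum>i<n. \<Sum>j<n. a i * a j * (min (t i) (t j) - t i * t j)))))"

definition conv_distr :: "'a measure \<Rightarrow> (nat \<Rightarrow> 'a \<Rightarrow> 'c::topological_space) \<Rightarrow> 'b measure \<Rightarrow> ('b \<Rightarrow> 'c) \<Rightarrow> bool" where
  "conv_distr M Y N Z \<longleftrightarrow> (\<forall>n. Y n \<in> borel_measurable M) \<and> Z \<in> borel_measurable N \<and>
     (\<forall>f :: 'c \<Rightarrow> real. continuous_on UNIV f \<and> bounded (range f) \<longrightarrow>
        (\<lambda>n. \<integral>\<omega>. f (Y n \<omega>) \<partial>M) \<longlonglongrightarrow> (\<integral>\<omega>. f (Z \<omega>) \<partial>N))"

end

theory Submission
  imports Defs "HOL-Real_Asymp.Real_Asymp"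
begin

text \<open>
Write $W_n = \sqrt n\,(p_n - p_0)$ and let $\Pi$ be the projection onto the cone $\mathcal C(\mathcal K)$.
If $|W_n|$ is at most a small multiple of $\sqrt n$, then $p_0 + \Pi(W_n)/\sqrt n$ is itself convex: the
strict convexity of $p_0$ at its knots (including $S+1$) absorbs the perturbation, and raising the last
coordinate is a feasible direction, so $\Pi(W_n)(S+1) \ge W_n(S+1) = 0$. It then satisfies the variational
inequality of the least squares problem, hence $\sqrt n\,(\hat p_n - p_0) = \Pi(W_n)$ exactly, with
probability tending to one. As $\Pi$ is continuous, the limit law is that of $\hat g = \Pi(\mathbb W)$.

The indicator of $\{0,\dots,s\}$ is feasible, so $\widehat{\mathbb G}(s) \ge \mathbb U(F_{p_0}(s))$ always, whereas
the minimizer of $\Phi^{\le s}$ always has total mass $\mathbb U(F_{p_0}(s))$. If the two laws agree on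
$\{0,\dots,s\}$, an ordered pair of random variables has equal laws, which forces almost sure equality.
The gap $\sqrt n\,(F_{\hat p_n}(s) - F_{p_n}(s))$ converges in law to
$\widehat{\mathbb G}(s) - \mathbb U(F_{p_0}(s))$, so it is negligible under the same condition.
\<close>

section \<open>Projection onto cones of vectors\<close>

text \<open>Weak convergence of \<open>dev n\<close> is needed only for functions of finitely many
  coordinates. For a linear form with coefficients \<open>a\<close>, both the central limit theorem
  and the bridge covariance give the characteristic function value
  \<open>exp (- linear_var p0 L a / 2)\<close>; tightness and trigonometric polynomials carry this
  over to bounded continuous functions.

  The index \<open>S + 1\<close> behaves like a knot: \<open>p0\<close> vanishes there, but its
  second difference is \<open>p0 S > 0\<close>. The cone imposes nothing at \<open>S + 1\<close>,
  and the only remaining danger is \<open>S + 2\<close>, where \<open>p0\<close> is flat and the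
  perturbation alone must have a nonnegative second difference. This is where the sign of the last
  coordinate enters.

  The restriction criterion is a decoupling at the knot \<open>s\<close>: when the masses up to
  \<open>s\<close> agree, the residuals on either side of \<open>s\<close> sum to zero, so vertical
  shifts of one side cost nothing and the two sides can be tested separately.\<close>

definition lsq_proj :: "(nat \<Rightarrow> real) set \<Rightarrow> nat \<Rightarrow> (nat \<Rightarrow> real) \<Rightarrow> (nat \<Rightarrow> real)" where
  "lsq_proj K n w = (THE g. g \<in> K \<and>
     (\<forall>h\<in>K. 1/2 * (\<Sum>k\<le>n. (g k - w k)^2) \<le> 1/2 * (\<Sum>k\<le>n. (h k - w k)^2)))"

text \<open>After division by \<open>e\<close> the quadratic term disappears as \<open>e\<close>
  shrinks. This turns minimality along a segment into a first-order inequality; \<open>e\<close>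
  stops at 1 because a cone can be followed back towards 0 only that far.\<close>

lemma first_order_nonpos:
  fixes a b :: real
  assumes "\<And>e. 0 < e \<Longrightarrow> e \<le> 1 \<Longrightarrow> 2 * e * a \<le> e^2 * b"
  shows "a \<le> 0"
proof (rule ccontr)
  assume a: "\<not> a \<le> 0"
  \<comment> \<open>With this choice \<open>e * b\<close> is at most \<open>a\<close>, against
    \<open>2 * a \<le> e * b\<close> and \<open>a > 0\<close>.\<close>
  define e where "e = min 1 (a / (\<bar>b\<bar> + 1))"
  have e: "0 < e" "e \<le> 1" "e \<le> a / (\<bar>b\<bar> + 1)"
    using a by (auto simp: e_def)
  have "e * (2 * a) \<le> e * (e * b)"
    using assms[OF e(1,2)] by (simp add: power2_eq_square algebra_simps)
  then have "2 * a \<le> e * b" using e(1) by simp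
  also have "\<dots> \<le> e * (\<bar>b\<bar> + 1)" using e(1) by (intro mult_left_mono) auto
  also have "\<dots> \<le> a" using e(3) by (simp add: pos_le_divide_eq)
  finally show False using a by simp
qed

text \<open>Tychonoff's theorem. A radius 0 pins a coordinate at 0, so vectors stored as sequences
  also lie in compact boxes.\<close>

lemma compact_coordinate_box:
  fixes r :: "nat \<Rightarrow> real"
  shows "compact {g. \<forall>k. \<bar>g k\<bar> \<le> r k}"
proof -
  have eq: "{g. \<forall>k. \<bar>g k\<bar> \<le> r k} = PiE UNIV (\<lambda>k. {- r k..r k})"
    by (auto simp: PiE_def Pi_def abs_le_iff minus_le_iff)
  have "compactin (product_topology (\<lambda>_. euclidean) UNIV) (PiE UNIV (\<lambda>k. {- r k..r k}))"
    by (subst compactin_PiE) auto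
  then show ?thesis
    by (simp add: eq euclidean_product_topology)
qed

text \<open>Convexity comes from \<open>add\<close> and \<open>scale\<close>. Closedness refers to
  the product topology on all sequences, which on \<open>vecs n\<close> is the usual topology of
  R^(n+1).\<close>

locale vec_cone =
  fixes K :: "(nat \<Rightarrow> real) set" and n :: nat
  assumes vecs: "K \<subseteq> vecs n"
    and zero: "(\<lambda>_. 0) \<in> K"
    and add: "g \<in> K \<Longrightarrow> h \<in> K \<Longrightarrow> (\<lambda>k. g k + h k) \<in> K"
    and scale: "g \<in> K \<Longrightarrow> 0 \<le> c \<Longrightarrow> (\<lambda>k. c * g k) \<in> K"
    and closed: "closed K"
begin

text \<open>Moreau's description of the projection onto a closed convex cone: the residual lies in
  the polar cone and is orthogonal to the projection.\<close>

definition is_proj :: "(nat \<Rightarrow> real) \<Rightarrow> (nat \<Rightarrow> real) \<Rightarrow> bool" where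
  "is_proj w g \<longleftrightarrow> g \<in> K \<and> (\<forall>h\<in>K. (\<Sum>k\<le>n. (w k - g k) * h k) \<le> 0)
     \<and> (\<Sum>k\<le>n. (w k - g k) * g k) = 0"

lemma minimizer_exists:
  "\<exists>g\<in>K. \<forall>h\<in>K. (\<Sum>k\<le>n. (g k - w k)^2) \<le> (\<Sum>k\<le>n. (h k - w k)^2)"
proof -
  define Q where "Q = (\<Sum>k\<le>n. (w k)^2)"
  \<comment> \<open>A competitor no worse than the zero vector satisfies
    \<open>\<bar>h k - w k\<bar> \<le> sqrt Q\<close>, hence lies in this box; a minimum over the
    box is therefore global.\<close>
  define r where "r k = (if k \<le> n then \<bar>w k\<bar> + sqrt Q else 0)" for k
  define B where "B = {g::nat\<Rightarrow>real. \<forall>k. \<bar>g k\<bar> \<le> r k}"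
  have Q0: "Q \<ge> 0" by (simp add: Q_def sum_nonneg)
  have comp: "compact (K \<inter> B)"
    unfolding B_def by (intro closed_Int_compact closed compact_coordinate_box)
  have z: "(\<lambda>_. 0) \<in> K \<inter> B"
    using zero Q0 by (auto simp: B_def r_def)
  have cont: "continuous_on (K \<inter> B) (\<lambda>g. \<Sum>k\<le>n. (g k - w k)^2)"
    by (intro continuous_intros continuous_on_subset[OF continuous_on_product_coordinates]) auto
  obtain g where g: "g \<in> K \<inter> B"
    "\<And>h. h \<in> K \<inter> B \<Longrightarrow> (\<Sum>k\<le>n. (g k - w k)^2) \<le> (\<Sum>k\<le>n. (h k - w k)^2)"
    using continuous_attains_inf[OF comp _ cont] z by blast
  have "(\<Sum>k\<le>n. (g k - w k)^2) \<le> (\<Sum>k\<le>n. (h k - w k)^2)" if h: "h \<in> K" for h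
  proof (cases "(\<Sum>k\<le>n. (h k - w k)^2) \<le> Q")
    case True
    have "\<bar>h k\<bar> \<le> r k" for k
    proof (cases "k \<le> n")
      case kn: True
      have "(h k - w k)^2 \<le> (\<Sum>k\<le>n. (h k - w k)^2)"
        by (rule member_le_sum) (use kn in auto)
      then have "\<bar>h k - w k\<bar> \<le> sqrt Q"
        using True real_le_rsqrt by fastforce
      then show ?thesis using kn by (simp add: r_def)
    next
      case False
      then show ?thesis using h vecs by (auto simp: r_def vecs_def)
    qed
    then show ?thesis using h g(2) by (auto simp: B_def)
  next
    case False
    have "(\<Sum>k\<le>n. (g k - w k)^2) \<le> Q" using g(2)[OF z] by (simp add: Q_def)
    with False show ?thesis by linarith
  qed
  with g(1) show ?thesis by blast
qed

lemma minimizer_iff_is_proj: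
  "g \<in> K \<and> (\<forall>h\<in>K. (\<Sum>k\<le>n. (g k - w k)^2) \<le> (\<Sum>k\<le>n. (h k - w k)^2)) \<longleftrightarrow> is_proj w g"
proof
  assume L: "g \<in> K \<and> (\<forall>h\<in>K. (\<Sum>k\<le>n. (g k - w k)^2) \<le> (\<Sum>k\<le>n. (h k - w k)^2))"
  then have gK: "g \<in> K" and
    min: "\<And>h. h \<in> K \<Longrightarrow> (\<Sum>k\<le>n. (g k - w k)^2) \<le> (\<Sum>k\<le>n. (h k - w k)^2)" by auto
  have exp: "(\<Sum>k\<le>n. (g k + e * h k - w k)^2) =
      (\<Sum>k\<le>n. (g k - w k)^2) - 2 * e * (\<Sum>k\<le>n. (w k - g k) * h k) + e^2 * (\<Sum>k\<le>n. (h k)^2)" for e h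
    by (simp add: sum_distrib_left sum_subtractf [symmetric] sum.distrib[symmetric]
        power2_eq_square algebra_simps)
  have le: "(\<Sum>k\<le>n. (w k - g k) * h k) \<le> 0" if "h \<in> K" for h
  proof (rule first_order_nonpos)
    fix e :: real assume "0 < e" "e \<le> 1"
    then have "(\<lambda>k. g k + e * h k) \<in> K" using add[OF gK scale[OF that]] by auto
    from min[OF this] show "2 * e * (\<Sum>k\<le>n. (w k - g k) * h k) \<le> e^2 * (\<Sum>k\<le>n. (h k)^2)"
      unfolding exp by simp
  qed
  \<comment> \<open>Shrinking \<open>g\<close> towards 0 stays in the cone, so \<open>g\<close> may
    be moved both ways along itself; this upgrades the inequality to orthogonality.\<close>
  have "- (\<Sum>k\<le>n. (w k - g k) * g k) \<le> 0"
  proof (rule first_order_nonpos)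
    fix e :: real assume "0 < e" "e \<le> 1"
    then have "(\<lambda>k. (1 - e) * g k) \<in> K" by (intro scale gK) auto
    then have "(\<lambda>k. g k + (-e) * g k) \<in> K" by (simp add: algebra_simps)
    from min[OF this] show "2 * e * - (\<Sum>k\<le>n. (w k - g k) * g k) \<le> e^2 * (\<Sum>k\<le>n. (g k)^2)"
      unfolding exp by simp
  qed
  with le gK show "is_proj w g" unfolding is_proj_def using le[OF gK] by fastforce
next
  assume R: "is_proj w g"
  have "(\<Sum>k\<le>n. (g k - w k)^2) \<le> (\<Sum>k\<le>n. (h k - w k)^2)" if "h \<in> K" for h
  proof -
    have "(\<Sum>k\<le>n. (h k - w k)^2) = (\<Sum>k\<le>n. (g k - w k)^2) + (\<Sum>k\<le>n. (h k - g k)^2)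
        - 2 * (\<Sum>k\<le>n. (w k - g k) * h k) + 2 * (\<Sum>k\<le>n. (w k - g k) * g k)"
      by (simp add: sum_distrib_left sum_subtractf [symmetric] sum.distrib[symmetric]
        power2_eq_square algebra_simps)
    moreover have "(\<Sum>k\<le>n. (h k - g k)^2) \<ge> 0" by (simp add: sum_nonneg)
    ultimately show ?thesis using R that unfolding is_proj_def by fastforce
  qed
  with R show "g \<in> K \<and> (\<forall>h\<in>K. (\<Sum>k\<le>n. (g k - w k)^2) \<le> (\<Sum>k\<le>n. (h k - w k)^2))"
    by (auto simp: is_proj_def)
qed

text \<open>The expansion contains the square of the difference of residuals and four products of
  residuals with projections: two vanish by orthogonality, the other two have the right sign because
  each residual is polar to the other projection. Uniqueness and continuity both follow.\<close>

lemma is_proj_contraction: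
  assumes "is_proj w g" "is_proj w' g'"
  shows "(\<Sum>k\<le>n. (g k - g' k)^2) \<le> (\<Sum>k\<le>n. (w k - w' k)^2)"
proof -
  have "(\<Sum>k\<le>n. (w k - w' k)^2) - (\<Sum>k\<le>n. (g k - g' k)^2) =
    (\<Sum>k\<le>n. ((w k - w' k) - (g k - g' k))^2)
     - 2 * (\<Sum>k\<le>n. (w k - g k) * g' k) - 2 * (\<Sum>k\<le>n. (w' k - g' k) * g k)
     + 2 * (\<Sum>k\<le>n. (w k - g k) * g k) + 2 * (\<Sum>k\<le>n. (w' k - g' k) * g' k)"
    by (simp add: sum_distrib_left sum_subtractf [symmetric] sum.distrib[symmetric]
        power2_eq_square algebra_simps)
  moreover have "(\<Sum>k\<le>n. ((w k - w' k) - (g k - g' k))^2) \<ge> 0" by (simp add: sum_nonneg)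
  moreover have "(\<Sum>k\<le>n. (w k - g k) * g' k) \<le> 0" "(\<Sum>k\<le>n. (w' k - g' k) * g k) \<le> 0"
    using assms by (auto simp: is_proj_def)
  moreover have "(\<Sum>k\<le>n. (w k - g k) * g k) = 0" "(\<Sum>k\<le>n. (w' k - g' k) * g' k) = 0"
    using assms by (auto simp: is_proj_def)
  ultimately show ?thesis by linarith
qed

lemma is_proj_unique:
  assumes "is_proj w g" "is_proj w g'"
  shows "g = g'"
proof
  fix k
  have "(\<Sum>k\<le>n. (g k - g' k)^2) \<le> 0"
    using is_proj_contraction[OF assms] by simp
  then have "(\<Sum>k\<le>n. (g k - g' k)^2) = 0" by (meson sum_nonneg zero_le_power2 order_antisym)
  then have "k \<le> n \<Longrightarrow> g k = g' k" by (subst (asm) sum_nonneg_eq_0_iff) auto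
  moreover have "g \<in> vecs n" "g' \<in> vecs n" using assms vecs by (auto simp: is_proj_def)
  ultimately show "g k = g' k" by (cases "k \<le> n") (auto simp: vecs_def)
qed

lemma minimizer_unique_exists:
  "\<exists>!g. g \<in> K \<and> (\<forall>h\<in>K. 1/2 * (\<Sum>k\<le>n. (g k - w k)^2) \<le> 1/2 * (\<Sum>k\<le>n. (h k - w k)^2))"
  using minimizer_exists[of w] minimizer_iff_is_proj[of _ w] is_proj_unique[of w] by simp metis

lemma lsq_proj_is_proj: "is_proj w (lsq_proj K n w)"
  using theI'[OF minimizer_unique_exists[of w]] minimizer_iff_is_proj
  unfolding lsq_proj_def by simp

lemma lsq_proj_eqI: "is_proj w g \<Longrightarrow> lsq_proj K n w = g"
  using lsq_proj_is_proj is_proj_unique by blast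

lemma lsq_proj_zero: "lsq_proj K n (\<lambda>_. 0) = (\<lambda>_. 0)"
  by (rule lsq_proj_eqI) (simp add: is_proj_def zero)

lemma lsq_proj_coord_contraction:
  assumes "k \<le> n"
  shows "(lsq_proj K n w k - lsq_proj K n w' k)^2 \<le> (\<Sum>j\<le>n. (w j - w' j)^2)"
proof -
  have "(lsq_proj K n w k - lsq_proj K n w' k)^2
      \<le> (\<Sum>k\<le>n. (lsq_proj K n w k - lsq_proj K n w' k)^2)"
    by (rule member_le_sum) (use assms in auto)
  also have "\<dots> \<le> (\<Sum>j\<le>n. (w j - w' j)^2)"
    by (intro is_proj_contraction lsq_proj_is_proj)
  finally show ?thesis .
qed

lemma lsq_proj_cong:
  assumes "\<And>k. k \<le> n \<Longrightarrow> w k = w' k"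
  shows "lsq_proj K n w = lsq_proj K n w'"
  unfolding lsq_proj_def using assms by simp

lemma lsq_proj_beyond: "k > n \<Longrightarrow> lsq_proj K n w k = 0"
  using lsq_proj_is_proj[of w] vecs by (auto simp: is_proj_def vecs_def)

text \<open>Continuity is checked coordinatewise. Coordinates beyond \<open>n\<close> are 0, the
  others are Lipschitz for the Euclidean distance of the first \<open>n + 1\<close> coordinates,
  which is itself continuous in the product topology.\<close>

lemma continuous_on_lsq_proj: "continuous_on A (lsq_proj K n)"
proof (rule continuous_on_subset[OF _ subset_UNIV], rule continuous_on_coordinatewise_then_product)
  fix k
  show "continuous_on UNIV (\<lambda>w. lsq_proj K n w k)"
  proof (cases "k \<le> n")
    case True
    show ?thesis unfolding continuous_on_def
    proof (intro ballI)
      fix w0 :: "nat \<Rightarrow> real"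
      have "continuous_on UNIV (\<lambda>w::nat\<Rightarrow>real. sqrt (\<Sum>j\<le>n. (w j - w0 j)^2))"
        by (intro continuous_intros continuous_on_product_coordinates)
      then have "((\<lambda>w. sqrt (\<Sum>j\<le>n. (w j - w0 j)^2)) \<longlongrightarrow> sqrt (\<Sum>j\<le>n. (w0 j - w0 j)^2)) (at w0)"
        unfolding continuous_on_def by blast
      then have lim: "((\<lambda>w. sqrt (\<Sum>j\<le>n. (w j - w0 j)^2)) \<longlongrightarrow> 0) (at w0)" by simp
      have "((\<lambda>w. lsq_proj K n w k - lsq_proj K n w0 k) \<longlongrightarrow> 0) (at w0)"
      proof (rule Lim_null_comparison[OF always_eventually lim], intro allI)
        fix w
        show "norm (lsq_proj K n w k - lsq_proj K n w0 k) \<le> sqrt (\<Sum>j\<le>n. (w j - w0 j)^2)"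
          using lsq_proj_coord_contraction[OF True, of w w0] real_le_rsqrt
          by (metis abs_le_square_iff power2_abs real_norm_def)
      qed
      then show "((\<lambda>w. lsq_proj K n w k) \<longlongrightarrow> lsq_proj K n w0 k) (at w0)"
        by (simp add: LIM_zero_iff)
    qed
  next
    case False
    then show ?thesis by (simp add: lsq_proj_beyond)
  qed
qed

end

section \<open>Weak convergence from limits of characteristic functions\<close>

text \<open>The free phase \<open>b\<close> provides sines and constants and makes the class closed
  under products. Expectations of its members are governed by characteristic functions of linear
  forms.\<close>

inductive trig_poly :: "nat \<Rightarrow> ((nat \<Rightarrow> real) \<Rightarrow> real) \<Rightarrow> bool" for L where
  cos: "trig_poly L (\<lambda>x. c * cos ((\<Sum>k\<le>L. a k * x k) + b))"
| add: "trig_poly L f \<Longrightarrow> trig_poly L g \<Longrightarrow> trig_poly L (\<lambda>x. f x + g x)"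

lemma trig_poly_const: "trig_poly L (\<lambda>_. c)"
  using trig_poly.cos[of L c "\<lambda>_. 0" 0] by simp

text \<open>Product-to-sum formula on the generators, then bilinearity.\<close>

lemma trig_poly_mult:
  assumes "trig_poly L f" "trig_poly L g"
  shows "trig_poly L (\<lambda>x. f x * g x)"
  using assms(1)
proof (induction rule: trig_poly.induct)
  case (cos c a b)
  show ?case using assms(2)
  proof (induction rule: trig_poly.induct)
    case (cos c' a' b')
    have "c * cos ((\<Sum>k\<le>L. a k * x k) + b) * (c' * cos ((\<Sum>k\<le>L. a' k * x k) + b')) =
       (c * c' / 2) * cos ((\<Sum>k\<le>L. (a k + a' k) * x k) + (b + b')) +
       (c * c' / 2) * cos ((\<Sum>k\<le>L. (a k - a' k) * x k) + (b - b'))" for x :: "nat \<Rightarrow> real"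
    proof -
      define u v where "u = (\<Sum>k\<le>L. a k * x k) + b" and "v = (\<Sum>k\<le>L. a' k * x k) + b'"
      have "(\<Sum>k\<le>L. (a k + a' k) * x k) + (b + b') = u + v"
        by (simp add: u_def v_def sum.distrib distrib_right)
      moreover have "(\<Sum>k\<le>L. (a k - a' k) * x k) + (b - b') = u - v"
        by (simp add: u_def v_def sum_subtractf left_diff_distrib)
      ultimately show ?thesis
        unfolding u_def[symmetric] v_def[symmetric] by (simp only: cos_add cos_diff) (simp add: field_simps)
    qed
    then show ?case by (simp only:) (intro trig_poly.intros)
  next
    case (add f g)
    then show ?case by (simp add: distrib_left) (intro trig_poly.intros)
  qed
next
  case (add f g)
  then show ?case by (simp add: distrib_right) (intro trig_poly.intros)
qed

lemma trig_poly_continuous: "trig_poly L f \<Longrightarrow> continuous_on UNIV f"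
  by (induction rule: trig_poly.induct)
     (auto intro!: continuous_intros continuous_on_product_coordinates)

lemma trig_poly_bounded: "trig_poly L f \<Longrightarrow> \<exists>C. \<forall>x. \<bar>f x\<bar> \<le> C"
proof (induction rule: trig_poly.induct)
  case (cos c a b)
  show ?case by (rule exI[of _ "\<bar>c\<bar>"]) (simp add: abs_mult mult_left_le)
next
  case (add f g)
  then obtain C D where "\<forall>x. \<bar>f x\<bar> \<le> C" "\<forall>x. \<bar>g x\<bar> \<le> D" by auto
  then have "\<bar>f x + g x\<bar> \<le> C + D" for x
    using abs_triangle_ineq[of "f x" "g x"] by (meson add_mono order_trans)
  then show ?case by blast
qed

lemma integrable_bounded_continuous:
  fixes f :: "(nat \<Rightarrow> real) \<Rightarrow> real"
  assumes "prob_space M" "Y \<in> borel_measurable M" "continuous_on UNIV f" "\<And>x. \<bar>f x\<bar> \<le> C"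
  shows "integrable M (\<lambda>\<omega>. f (Y \<omega>))"
proof -
  interpret prob_space M by fact
  have "(\<lambda>\<omega>. f (Y \<omega>)) \<in> borel_measurable M"
    by (rule measurable_compose[OF assms(2) borel_measurable_continuous_onI[OF assms(3)]])
  then show ?thesis
    using assms(4) by (intro integrable_const_bound[of _ C]) auto
qed

text \<open>Off \<open>E\<close> the integrands differ by at most \<open>e\<close>, on
  \<open>E\<close> by at most \<open>C + C'\<close>. With a tail event for \<open>E\<close> this is
  a truncation bound, with \<open>E\<close> empty a uniform approximation bound.\<close>

lemma expectation_diff_le:
  fixes f q :: "(nat \<Rightarrow> real) \<Rightarrow> real"
  assumes Q: "prob_space Q" and Y: "Y \<in> borel_measurable Q"
    and f: "continuous_on UNIV f" "\<And>x. \<bar>f x\<bar> \<le> C" and q: "continuous_on UNIV q" "\<And>x. \<bar>q x\<bar> \<le> C'"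
    and E: "E \<in> sets Q" and out: "\<And>\<omega>. \<omega> \<in> space Q \<Longrightarrow> \<omega> \<notin> E \<Longrightarrow> \<bar>f (Y \<omega>) - q (Y \<omega>)\<bar> \<le> e"
    and e: "0 \<le> e"
  shows "\<bar>(\<integral>\<omega>. f (Y \<omega>) \<partial>Q) - (\<integral>\<omega>. q (Y \<omega>) \<partial>Q)\<bar> \<le> e + (C + C') * measure Q E"
proof -
  interpret Q: prob_space Q by fact
  have i1: "integrable Q (\<lambda>\<omega>. f (Y \<omega>))" by (rule integrable_bounded_continuous[OF Q Y f])
  have i2: "integrable Q (\<lambda>\<omega>. q (Y \<omega>))" by (rule integrable_bounded_continuous[OF Q Y q])
  have i3: "integrable Q (indicat_real E)" using E by (simp add: Q.emeasure_finite less_top[symmetric])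
  have "\<bar>\<integral>\<omega>. f (Y \<omega>) - q (Y \<omega>) \<partial>Q\<bar> \<le> (\<integral>\<omega>. \<bar>f (Y \<omega>) - q (Y \<omega>)\<bar> \<partial>Q)"
    by (rule integral_abs_bound)
  also have "\<dots> \<le> (\<integral>\<omega>. e + (C + C') * indicat_real E \<omega> \<partial>Q)"
  proof (rule integral_mono)
    show "\<bar>f (Y \<omega>) - q (Y \<omega>)\<bar> \<le> e + (C + C') * indicat_real E \<omega>" if "\<omega> \<in> space Q" for \<omega>
      using out[OF that] f(2)[of "Y \<omega>"] q(2)[of "Y \<omega>"] e by (cases "\<omega> \<in> E") auto
  qed (use i1 i2 i3 in auto)
  also have "\<dots> = e + (C + C') * measure Q E"
    using i3 E by (simp add: Q.prob_space)
  finally show ?thesis using i1 i2 by simp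
qed

lemma trig_poly_expectation_tendsto:
  fixes A :: "nat \<Rightarrow> 'a \<Rightarrow> nat \<Rightarrow> real" and B :: "'b \<Rightarrow> nat \<Rightarrow> real"
  assumes "prob_space M" "prob_space N"
    and "\<And>n. A n \<in> borel_measurable M" "B \<in> borel_measurable N"
    and char: "\<And>a b. (\<lambda>n. \<integral>\<omega>. cos ((\<Sum>k\<le>L. a k * A n \<omega> k) + b) \<partial>M)
          \<longlonglongrightarrow> (\<integral>\<omega>. cos ((\<Sum>k\<le>L. a k * B \<omega> k) + b) \<partial>N)"
    and "trig_poly L f"
  shows "(\<lambda>n. \<integral>\<omega>. f (A n \<omega>) \<partial>M) \<longlonglongrightarrow> (\<integral>\<omega>. f (B \<omega>) \<partial>N)"
  using assms(6)
proof (induction rule: trig_poly.induct)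
  case (cos c a b)
  show ?case by (simp add: tendsto_mult_left[OF char])
next
  case (add f g)
  have int: "integrable M (\<lambda>\<omega>. h (A n \<omega>))" "integrable N (\<lambda>\<omega>. h (B \<omega>))" if "trig_poly L h" for h n
    using trig_poly_bounded[OF that] trig_poly_continuous[OF that] assms(1-4)
    by (metis integrable_bounded_continuous)+
  show ?case using add by (simp add: int tendsto_add)
qed

lemma tendsto_coordinatewise:
  fixes x :: "'c \<Rightarrow> 'd \<Rightarrow> 'e::topological_space"
  assumes "\<And>k. ((\<lambda>m. x m k) \<longlongrightarrow> l k) F"
  shows "(x \<longlongrightarrow> l) F"
proof -
  have "limitin (product_topology (\<lambda>_. euclidean) UNIV) x l F"
    using assms by (simp add: limitin_componentwise)
  then show ?thesis by (simp add: euclidean_product_topology)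
qed

text \<open>
Replacing $x$ by $R \sin(x/R)$ changes $f$ little on bounded sets, and on all of space $f(R \sin(x/R))$ is
a uniform limit of trigonometric polynomials, by Stone--Weierstrass for polynomials in the sines.
\<close>

lemma scaled_sin_approx:
  fixes u R :: real
  assumes "R > 0"
  shows "\<bar>R * sin (u / R) - u\<bar> \<le> u^2 / (2 * R)"
proof -
  have "\<bar>sin (u/R) - (\<Sum>m<2. sin_coeff m * (u/R)^m)\<bar> \<le> inverse (fact 2) * \<bar>u/R\<bar>^2"
    by (rule Maclaurin_sin_bound)
  then have *: "\<bar>sin (u/R) - u/R\<bar> \<le> (u/R)^2 / 2"
    by (simp add: numeral_2_eq_2 sin_coeff_def)
  have "R * sin (u / R) - u = R * (sin (u/R) - u/R)"
    using assms by (simp add: algebra_simps)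
  then have "\<bar>R * sin (u / R) - u\<bar> = R * \<bar>sin (u/R) - u/R\<bar>"
    using assms by (simp add: abs_mult)
  also have "\<dots> \<le> R * ((u/R)^2 / 2)" using * assms by (intro mult_left_mono) auto
  also have "\<dots> = u^2 / (2 * R)" using assms by (simp add: power2_eq_square field_simps)
  finally show ?thesis .
qed

text \<open>A compactness argument: if every scale failed, there would be a bad point of the box for
  each positive integer scale. Along a convergent subsequence the points and their sine images have
  the same limit, against continuity of \<open>f\<close>.\<close>

lemma scaled_sin_uniform_approx:
  fixes f :: "(nat \<Rightarrow> real) \<Rightarrow> real"
  assumes cont: "continuous_on UNIV f"
    and dep: "\<And>x y. (\<And>k. k \<le> L \<Longrightarrow> x k = y k) \<Longrightarrow> f x = f y"
    and e: "e > 0"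
  shows "\<exists>R>0. \<forall>x. (\<forall>k\<le>L. \<bar>x k\<bar> \<le> D) \<longrightarrow> \<bar>f x - f (\<lambda>k. R * sin (x k / R))\<bar> < e"
proof (rule ccontr)
  assume neg: "\<not> ?thesis"
  define T :: "nat \<Rightarrow> (nat \<Rightarrow> real) \<Rightarrow> nat \<Rightarrow> real"
    where "T m x = (\<lambda>k. real (Suc m) * sin (x k / real (Suc m)))" for m x
  have "\<exists>x. (\<forall>k\<le>L. \<bar>x k\<bar> \<le> D) \<and> \<not> \<bar>f x - f (T m x)\<bar> < e" for m
    using neg unfolding T_def by (metis of_nat_0_less_iff zero_less_Suc)
  then obtain y where y: "\<And>m. \<forall>k\<le>L. \<bar>y m k\<bar> \<le> D" "\<And>m. \<not> \<bar>f (y m) - f (T m (y m))\<bar> < e"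
    by metis
  \<comment> \<open>The bound says nothing about coordinates above \<open>L\<close>; setting them to
    0 gives points of a compact box, and \<open>dep\<close> leaves the values of \<open>f\<close>
    unchanged.\<close>
  define x where "x m k = (if k \<le> L then y m k else 0)" for m k
  have fx: "f (x m) = f (y m)" "f (T m (x m)) = f (T m (y m))" for m
    by (rule dep, simp add: x_def T_def)+
  have D0: "0 \<le> D" using y(1)[of 0] by force
  have xB: "\<bar>x m k\<bar> \<le> D" for m k using y(1)[of m] D0 by (simp add: x_def)
  have "compact {g::nat\<Rightarrow>real. \<forall>k. \<bar>g k\<bar> \<le> D}" by (rule compact_coordinate_box)
  then have "seq_compact {g::nat\<Rightarrow>real. \<forall>k. \<bar>g k\<bar> \<le> D}" by (rule compact_imp_seq_compact)
  then obtain l r where lr: "strict_mono r" "(x \<circ> r) \<longlonglongrightarrow> l"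
    unfolding seq_compact_def using xB by blast
  have lk: "(\<lambda>m. x (r m) k) \<longlonglongrightarrow> l k" for k
    using continuous_on_tendsto_compose[OF continuous_on_product_coordinates[of k] lr(2)]
    by (simp add: o_def)
  have "(\<lambda>m. T (r m) (x (r m)) k - x (r m) k) \<longlonglongrightarrow> 0" for k
  proof (rule Lim_null_comparison)
    have "\<bar>T (r m) (x (r m)) k - x (r m) k\<bar> \<le> D^2 / (2 * real (Suc m))" for m
    proof -
      have "\<bar>T (r m) (x (r m)) k - x (r m) k\<bar> \<le> (x (r m) k)^2 / (2 * real (Suc (r m)))"
        unfolding T_def by (rule scaled_sin_approx) simp
      also have "\<dots> \<le> D^2 / (2 * real (Suc m))"
        using xB[of "r m" k] seq_suble[OF lr(1), of m] D0
        by (intro frac_le) (auto simp: abs_le_square_iff[symmetric])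
      finally show ?thesis .
    qed
    then show "\<forall>\<^sub>F m in sequentially. norm (T (r m) (x (r m)) k - x (r m) k) \<le> D^2 / (2 * real (Suc m))"
      by simp
    show "(\<lambda>m. D^2 / (2 * real (Suc m))) \<longlonglongrightarrow> 0" by real_asymp
  qed
  then have "(\<lambda>m. T (r m) (x (r m)) k) \<longlonglongrightarrow> l k" for k
    using tendsto_add[OF _ lk, of "\<lambda>m. T (r m) (x (r m)) k - x (r m) k" 0 k] by simp
  then have "(\<lambda>m. T (r m) (x (r m))) \<longlonglongrightarrow> l" by (rule tendsto_coordinatewise)
  then have "(\<lambda>m. f (T (r m) (x (r m)))) \<longlonglongrightarrow> f l"
    by (rule continuous_on_tendsto_compose[OF cont]) auto
  moreover have "(\<lambda>m. f (x (r m))) \<longlonglongrightarrow> f l"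
    using continuous_on_tendsto_compose[OF cont lr(2)] by (simp add: o_def)
  ultimately have "(\<lambda>m. f (x (r m)) - f (T (r m) (x (r m)))) \<longlonglongrightarrow> f l - f l"
    by (intro tendsto_diff)
  then have "(\<lambda>m. f (x (r m)) - f (T (r m) (x (r m)))) \<longlonglongrightarrow> 0" by simp
  from LIMSEQ_D[OF this e] obtain m0 where "\<bar>f (x (r m0)) - f (T (r m0) (x (r m0)))\<bar> < e" by auto
  with y(2)[of "r m0"] show False by (simp add: fx)
qed

lemma scaled_sin_expectation_tendsto:
  fixes A :: "nat \<Rightarrow> 'a \<Rightarrow> nat \<Rightarrow> real" and B :: "'b \<Rightarrow> nat \<Rightarrow> real"
  assumes M: "prob_space M" and N: "prob_space N"
    and A: "\<And>n. A n \<in> borel_measurable M" and B: "B \<in> borel_measurable N"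
    and char: "\<And>a b. (\<lambda>n. \<integral>\<omega>. cos ((\<Sum>k\<le>L. a k * A n \<omega> k) + b) \<partial>M)
          \<longlonglongrightarrow> (\<integral>\<omega>. cos ((\<Sum>k\<le>L. a k * B \<omega> k) + b) \<partial>N)"
    and cont: "continuous_on UNIV (f :: (nat \<Rightarrow> real) \<Rightarrow> real)" and C: "\<And>x. \<bar>f x\<bar> \<le> C"
    and dep: "\<And>x y. (\<And>k. k \<le> L \<Longrightarrow> x k = y k) \<Longrightarrow> f x = f y"
    and R: "R > 0"
  shows "(\<lambda>n. \<integral>\<omega>. f (\<lambda>k. R * sin (A n \<omega> k / R)) \<partial>M)
     \<longlonglongrightarrow> (\<integral>\<omega>. f (\<lambda>k. R * sin (B \<omega> k / R)) \<partial>N)"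
proof (rule LIMSEQ_I)
  fix e :: real assume e: "e > 0"
  define tr :: "(nat \<Rightarrow> real) \<Rightarrow> nat \<Rightarrow> real" where "tr x k = (if k \<le> L then sin (x k / R) else 0)" for x k
  define Sq where "Sq = {y::nat\<Rightarrow>real. \<forall>k. \<bar>y k\<bar> \<le> (if k \<le> L then 1 else 0)}"
  \<comment> \<open>\<open>P\<close> is an algebra of continuous functions whose composition with
    the truncated sines \<open>tr\<close> is a trigonometric polynomial. Since \<open>tr\<close>
    takes values in the compact cube \<open>Sq\<close>, approximation on \<open>Sq\<close> is
    uniform approximation everywhere after composition.\<close>
  define P :: "((nat \<Rightarrow> real) \<Rightarrow> real) \<Rightarrow> bool" where "P g \<longleftrightarrow> continuous_on UNIV g \<and> trig_poly L (\<lambda>x. g (tr x))" for g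
  have contT: "continuous_on UNIV (\<lambda>x::nat\<Rightarrow>real. f (\<lambda>k. R * x k))"
    by (rule continuous_on_compose2[OF cont])
       (auto intro!: continuous_on_coordinatewise_then_product continuous_intros continuous_on_product_coordinates)
  have "\<exists>g. P g \<and> (\<forall>x\<in>Sq. \<bar>f (\<lambda>k. R * x k) - g x\<bar> < e/3)"
  proof (rule Stone_Weierstrass_HOL)
    show "compact Sq" unfolding Sq_def by (rule compact_coordinate_box)
    show "P (\<lambda>x. c)" for c by (simp add: P_def trig_poly_const)
    show "P g \<Longrightarrow> continuous_on Sq g" for g by (auto simp: P_def intro: continuous_on_subset)
    show "P g \<and> P h \<Longrightarrow> P (\<lambda>x. g x + h x)" for g h
      by (auto simp: P_def intro!: continuous_intros trig_poly.add)
    show "P g \<and> P h \<Longrightarrow> P (\<lambda>x. g x * h x)" for g h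
      by (auto simp: P_def intro!: continuous_intros trig_poly_mult)
    show "\<exists>g. P g \<and> g x \<noteq> g y" if xy: "x \<in> Sq \<and> y \<in> Sq \<and> x \<noteq> y" for x y
    proof -
      from xy obtain k where k: "x k \<noteq> y k" by auto
      have "k \<le> L" 
      proof (rule ccontr)
        assume "\<not> k \<le> L"
        with xy have "x k = 0" "y k = 0" unfolding Sq_def by (auto dest!: spec[of _ k])
        with k show False by simp
      qed
      \<comment> \<open>Coordinate functions separate points of \<open>Sq\<close>; composed with
        \<open>tr\<close> they become sines, that is, cosines with phase
        \<open>- (pi / 2)\<close>.\<close>
      moreover have "trig_poly L (\<lambda>x. sin (x k / R))" if "k \<le> L"
      proof -
        have "(\<Sum>j\<le>L. (if j = k then 1 / R else 0) * x j) = x k / R" for x :: "nat \<Rightarrow> real"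
          using that by (simp add: if_distrib[of "\<lambda>c. c * _"] sum.delta cong: if_cong)
        then show ?thesis
          using trig_poly.cos[of L 1 "\<lambda>j. if j = k then 1 / R else 0" "- (pi / 2)"]
          by (simp add: cos_diff)
      qed
      ultimately have "P (\<lambda>x. x k)" by (simp add: P_def tr_def)
      with k show ?thesis by blast
    qed
    show "continuous_on Sq (\<lambda>x. f (\<lambda>k. R * x k))" by (rule continuous_on_subset[OF contT]) auto
    show "e/3 > 0" using e by simp
  qed
  then obtain g where g: "P g" "\<And>x. x \<in> Sq \<Longrightarrow> \<bar>f (\<lambda>k. R * x k) - g x\<bar> < e/3" by blast
  define q where "q x = g (tr x)" for x
  have q: "trig_poly L q" using g(1) by (simp add: P_def q_def[abs_def])
  have close: "\<bar>f (\<lambda>k. R * sin (x k / R)) - q x\<bar> \<le> e/3" for x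
  proof -
    have "tr x \<in> Sq" by (auto simp: Sq_def tr_def)
    moreover have "f (\<lambda>k. R * sin (x k / R)) = f (\<lambda>k. R * tr x k)"
      by (rule dep) (simp add: tr_def)
    ultimately show ?thesis using g(2)[of "tr x"] by (simp add: q_def)
  qed
  have cont': "continuous_on UNIV (\<lambda>x. f (\<lambda>k. R * sin (x k / R)))"
    by (rule continuous_on_compose2[OF cont])
       (use R in \<open>auto intro!: continuous_on_coordinatewise_then_product continuous_intros continuous_on_product_coordinates\<close>)
  obtain C' where C': "\<And>x. \<bar>q x\<bar> \<le> C'" using trig_poly_bounded[OF q] by blast
  have e3: "0 \<le> e/3" using e by simp
  note diff = expectation_diff_le[OF _ _ cont' C trig_poly_continuous[OF q] C' sets.empty_sets close e3,
      unfolded measure_empty mult_zero_right add_0_right]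
  have "(\<lambda>n. \<integral>\<omega>. q (A n \<omega>) \<partial>M) \<longlonglongrightarrow> (\<integral>\<omega>. q (B \<omega>) \<partial>N)"
    by (rule trig_poly_expectation_tendsto[OF M N A B char q])
  from LIMSEQ_D[OF this, of "e/3"] e obtain n0 where
    n0: "\<And>n. n \<ge> n0 \<Longrightarrow> \<bar>(\<integral>\<omega>. q (A n \<omega>) \<partial>M) - (\<integral>\<omega>. q (B \<omega>) \<partial>N)\<bar> < e/3" by auto
  have "\<bar>(\<integral>\<omega>. f (\<lambda>k. R * sin (A n \<omega> k / R)) \<partial>M) - (\<integral>\<omega>. f (\<lambda>k. R * sin (B \<omega> k / R)) \<partial>N)\<bar> < e"
    if "n \<ge> n0" for n
  proof -
    show ?thesis using n0[OF that] diff[OF M A[of n]] diff[OF N B] e by linarith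
  qed
  then show "\<exists>n0. \<forall>n\<ge>n0. norm ((\<integral>\<omega>. f (\<lambda>k. R * sin (A n \<omega> k / R)) \<partial>M)
     - (\<integral>\<omega>. f (\<lambda>k. R * sin (B \<omega> k / R)) \<partial>N)) < e" by auto
qed

text \<open>The error \<open>e\<close> is spent in five shares: on each side one for replacing
  coordinates by scaled sines on a box and one for the mass outside the box, and one for convergence
  after the replacement. The scale \<open>R\<close> is fixed before \<open>n\<close>, hence
  tightness uniform in \<open>n\<close>.\<close>

lemma weak_limit_of_characteristic_limit:
  fixes A :: "nat \<Rightarrow> 'a \<Rightarrow> nat \<Rightarrow> real" and B :: "'b \<Rightarrow> nat \<Rightarrow> real"
  assumes M: "prob_space M" and N: "prob_space N"
    and A: "\<And>n. A n \<in> borel_measurable M" and B: "B \<in> borel_measurable N"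
    and char: "\<And>a b. (\<lambda>n. \<integral>\<omega>. cos ((\<Sum>k\<le>L. a k * A n \<omega> k) + b) \<partial>M)
          \<longlonglongrightarrow> (\<integral>\<omega>. cos ((\<Sum>k\<le>L. a k * B \<omega> k) + b) \<partial>N)"
    and tight: "\<And>e. e > 0 \<Longrightarrow>
          \<exists>D. \<forall>n. measure M {\<omega> \<in> space M. \<exists>k\<le>L. \<bar>A n \<omega> k\<bar> > D} < e"
    and cont: "continuous_on UNIV (f :: (nat \<Rightarrow> real) \<Rightarrow> real)" and C: "\<And>x. \<bar>f x\<bar> \<le> C"
    and dep: "\<And>x y. (\<And>k. k \<le> L \<Longrightarrow> x k = y k) \<Longrightarrow> f x = f y"
  shows "(\<lambda>n. \<integral>\<omega>. f (A n \<omega>) \<partial>M) \<longlonglongrightarrow> (\<integral>\<omega>. f (B \<omega>) \<partial>N)"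
proof (rule LIMSEQ_I)
  fix e :: real assume e: "e > 0"
  interpret N: prob_space N by fact
  interpret M: prob_space M by fact
  have C0: "0 \<le> C" using C[of undefined] by linarith
  \<comment> \<open>Mass below \<open>d\<close> outside the box then costs at most
    \<open>e / 5\<close>; the summand 1 covers \<open>C = 0\<close>.\<close>
  define d where "d = e / (5 * (2 * C + 1))"
  have d: "d > 0" "2 * C * d \<le> e / 5" using e C0 by (auto simp: d_def field_simps)
  have coordA [measurable]: "(\<lambda>\<omega>. A n \<omega> k) \<in> borel_measurable M" for n k
    using A[of n] by (rule measurable_compose[OF _ borel_measurable_continuous_onI]) simp
  have coordB [measurable]: "(\<lambda>\<omega>. B \<omega> k) \<in> borel_measurable N" for k
    using B by (rule measurable_compose[OF _ borel_measurable_continuous_onI]) simp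
  obtain D where D: "\<And>n. measure M {\<omega> \<in> space M. \<exists>k\<le>L. \<bar>A n \<omega> k\<bar> > D} < d"
    using tight[OF d(1)] by blast
  \<comment> \<open>A single random vector is tight: these tail events decrease to the empty
    set.\<close>
  define EB where "EB m = {\<omega> \<in> space N. \<exists>k\<le>L. \<bar>B \<omega> k\<bar> > real m}" for m
  have "(\<lambda>m. measure N (EB m)) \<longlonglongrightarrow> measure N (\<Inter>m. EB m)"
  proof (rule N.finite_Lim_measure_decseq)
    show "range EB \<subseteq> sets N" unfolding EB_def by auto
    show "decseq EB" unfolding EB_def decseq_def by (auto intro: order_le_less_trans)
  qed
  moreover have "(\<Inter>m. EB m) = {}"
  proof (rule equals0I)
    fix \<omega> assume w: "\<omega> \<in> (\<Inter>m. EB m)"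
    obtain m where m: "(\<Sum>k\<le>L. \<bar>B \<omega> k\<bar>) \<le> real m" using real_arch_simple by blast
    from w obtain k where "k \<le> L" "\<bar>B \<omega> k\<bar> > real m" unfolding EB_def by blast
    moreover have "\<bar>B \<omega> k\<bar> \<le> (\<Sum>k\<le>L. \<bar>B \<omega> k\<bar>)"
      by (rule member_le_sum) (use \<open>k \<le> L\<close> in auto)
    ultimately show False using m by linarith
  qed
  ultimately have "(\<lambda>m. measure N (EB m)) \<longlonglongrightarrow> 0" by simp
  from LIMSEQ_D[OF this d(1)] obtain m0 where m0: "measure N (EB m0) < d" by auto
  define D' where "D' = max D (real m0)"
  obtain R where R: "R > 0" "\<And>x. (\<forall>k\<le>L. \<bar>x k\<bar> \<le> D') \<Longrightarrow> \<bar>f x - f (\<lambda>k. R * sin (x k / R))\<bar> < e/5"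
    using scaled_sin_uniform_approx[OF cont dep, of L "e/5" D'] e by auto
  have cont': "continuous_on UNIV (\<lambda>x. f (\<lambda>k. R * sin (x k / R)))"
    by (rule continuous_on_compose2[OF cont])
       (use R(1) in \<open>auto intro!: continuous_on_coordinatewise_then_product continuous_intros\<close>)
  have dA: "\<bar>(\<integral>\<omega>. f (A n \<omega>) \<partial>M) - (\<integral>\<omega>. f (\<lambda>k. R * sin (A n \<omega> k / R)) \<partial>M)\<bar> \<le> e/5 + e/5" for n
  proof -
    let ?E = "{\<omega> \<in> space M. \<exists>k\<le>L. \<bar>A n \<omega> k\<bar> > D}"
    have "\<bar>(\<integral>\<omega>. f (A n \<omega>) \<partial>M) - (\<integral>\<omega>. f (\<lambda>k. R * sin (A n \<omega> k / R)) \<partial>M)\<bar>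
        \<le> e/5 + (C + C) * measure M ?E"
    proof (rule expectation_diff_le[OF M A cont C cont' C])
      fix \<omega> assume "\<omega> \<in> space M" "\<omega> \<notin> ?E"
      then have "\<forall>k\<le>L. \<bar>A n \<omega> k\<bar> \<le> D'" unfolding D'_def by force
      from R(2)[OF this] show "\<bar>f (A n \<omega>) - f (\<lambda>k. R * sin (A n \<omega> k / R))\<bar> \<le> e/5" by simp
    qed (use e in auto)
    also have "(C + C) * measure M ?E \<le> 2 * C * d"
      using D[of n] C0 by (simp add: mult_left_mono)
    finally show ?thesis using d(2) by linarith
  qed
  have dB: "\<bar>(\<integral>\<omega>. f (B \<omega>) \<partial>N) - (\<integral>\<omega>. f (\<lambda>k. R * sin (B \<omega> k / R)) \<partial>N)\<bar> \<le> e/5 + e/5"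
  proof -
    have "\<bar>(\<integral>\<omega>. f (B \<omega>) \<partial>N) - (\<integral>\<omega>. f (\<lambda>k. R * sin (B \<omega> k / R)) \<partial>N)\<bar>
        \<le> e/5 + (C + C) * measure N (EB m0)"
    proof (rule expectation_diff_le[OF N B cont C cont' C])
      fix \<omega> assume "\<omega> \<in> space N" "\<omega> \<notin> EB m0"
      then have "\<forall>k\<le>L. \<bar>B \<omega> k\<bar> \<le> D'" unfolding D'_def EB_def by force
      from R(2)[OF this] show "\<bar>f (B \<omega>) - f (\<lambda>k. R * sin (B \<omega> k / R))\<bar> \<le> e/5" by simp
    next
      show "EB m0 \<in> sets N" unfolding EB_def by measurable
    qed (use e in auto)
    also have "(C + C) * measure N (EB m0) \<le> 2 * C * d"
      using m0 C0 by (simp add: mult_left_mono)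
    finally show ?thesis using d(2) by linarith
  qed
  have "(\<lambda>n. \<integral>\<omega>. f (\<lambda>k. R * sin (A n \<omega> k / R)) \<partial>M)
     \<longlonglongrightarrow> (\<integral>\<omega>. f (\<lambda>k. R * sin (B \<omega> k / R)) \<partial>N)"
    by (rule scaled_sin_expectation_tendsto[OF M N A B char cont C dep R(1)])
  from LIMSEQ_D[OF this, of "e/5"] e obtain n0 where
    n0: "\<And>n. n \<ge> n0 \<Longrightarrow> \<bar>(\<integral>\<omega>. f (\<lambda>k. R * sin (A n \<omega> k / R)) \<partial>M)
       - (\<integral>\<omega>. f (\<lambda>k. R * sin (B \<omega> k / R)) \<partial>N)\<bar> < e/5" by auto
  have "\<bar>(\<integral>\<omega>. f (A n \<omega>) \<partial>M) - (\<integral>\<omega>. f (B \<omega>) \<partial>N)\<bar> < e" if "n \<ge> n0" for n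
    using n0[OF that] dA[of n] dB by linarith
  then show "\<exists>n0. \<forall>n\<ge>n0. norm ((\<integral>\<omega>. f (A n \<omega>) \<partial>M) - (\<integral>\<omega>. f (B \<omega>) \<partial>N)) < e" by auto
qed

section \<open>Fluctuations of the empirical distribution\<close>

lemma (in prob_space) expectation_cos_shift:
  assumes "Y \<in> borel_measurable M"
  shows "expectation (\<lambda>\<omega>. cos (Y \<omega> + b)) = Re (cis b * (\<integral>\<omega>. cis (Y \<omega>) \<partial>M))"
proof -
  have meas: "(\<lambda>\<omega>. cis (Y \<omega>)) \<in> borel_measurable M"
    using assms by (rule measurable_compose[OF _ borel_measurable_continuous_onI]) (intro continuous_intros)
  have int: "integrable M (\<lambda>\<omega>. cis (Y \<omega>))"
    by (rule integrable_const_bound[of _ 1]) (use meas in auto)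
  have "Re (cis b * (\<integral>\<omega>. cis (Y \<omega>) \<partial>M)) = Re (\<integral>\<omega>. cis b * cis (Y \<omega>) \<partial>M)"
    by (simp add: int)
  also have "\<dots> = (\<integral>\<omega>. Re (cis b * cis (Y \<omega>)) \<partial>M)"
    by (rule integral_Re[symmetric]) (simp add: int)
  also have "\<dots> = expectation (\<lambda>\<omega>. cos (Y \<omega> + b))"
    by (simp add: cis_mult add.commute)
  finally show ?thesis by simp
qed

text \<open>For a probability mass function carried by \<open>{0..L}\<close> this is the variance of
  \<open>a\<close>. The empirical and the bridge computations meet in this expression.\<close>

definition linear_var :: "(nat \<Rightarrow> real) \<Rightarrow> nat \<Rightarrow> (nat \<Rightarrow> real) \<Rightarrow> real" where
  "linear_var p L a = (\<Sum>k\<le>L. (a k)^2 * p k) - (\<Sum>k\<le>L. a k * p k)^2"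

locale iid_sample = prob_space M for M :: "'a measure" +
  fixes X :: "nat \<Rightarrow> 'a \<Rightarrow> nat" and p0 :: "nat \<Rightarrow> real" and S :: nat
  assumes nonneg: "\<And>k. p0 k \<ge> 0"
    and total: "(\<Sum>k\<le>S. p0 k) = 1"
    and beyond: "\<And>k. k > S \<Longrightarrow> p0 k = 0"
    and indep: "indep_vars (\<lambda>_. count_space UNIV) X {1..}"
    and distr: "\<And>i j. i \<ge> 1 \<Longrightarrow> prob {\<omega> \<in> space M. X i \<omega> = j} = p0 j"
begin

lemma X_measurable: "i \<ge> 1 \<Longrightarrow> X i \<in> measurable M (count_space UNIV)"
  using indep by (auto simp: indep_vars_def)

lemma fun_X_measurable: "i \<ge> 1 \<Longrightarrow> (\<lambda>\<omega>. g (X i \<omega>) :: real) \<in> borel_measurable M"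
  by (rule measurable_compose[OF X_measurable]) auto

lemma X_event: "i \<ge> 1 \<Longrightarrow> {\<omega> \<in> space M. X i \<omega> = j} \<in> events"
proof -
  assume "i \<ge> 1"
  from measurable_sets[OF X_measurable[OF this], of "{j}"] have "X i -` {j} \<inter> space M \<in> events" by simp
  also have "X i -` {j} \<inter> space M = {\<omega> \<in> space M. X i \<omega> = j}" by auto
  finally show ?thesis .
qed

text \<open>The point masses up to \<open>S\<close> already add up to one.\<close>

lemma AE_X_le:
  assumes i: "i \<ge> 1"
  shows "AE \<omega> in M. X i \<omega> \<le> S"
proof -
  have "prob (\<Union>k\<in>{..S}. {\<omega> \<in> space M. X i \<omega> = k}) = (\<Sum>k\<le>S. prob {\<omega> \<in> space M. X i \<omega> = k})"
    by (rule finite_measure_finite_Union) (auto simp: X_event[OF i] disjoint_family_on_def image_subset_iff)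
  then have "prob (\<Union>k\<in>{..S}. {\<omega> \<in> space M. X i \<omega> = k}) = 1" using i by (simp add: distr total)
  from AE_prob_1[OF this] show ?thesis by eventually_elim auto
qed

text \<open>Almost surely \<open>g (X i \<omega>)\<close> is a finite combination of indicators, so
  any \<open>g\<close> is integrable and its mean can be read off.\<close>

lemma
  assumes i: "i \<ge> 1"
  shows integrable_fun_X: "integrable M (\<lambda>\<omega>. g (X i \<omega>) :: real)"
    and expectation_fun_X: "expectation (\<lambda>\<omega>. g (X i \<omega>)) = (\<Sum>k\<le>S. g k * p0 k)"
proof -
  let ?f = "\<lambda>\<omega>. \<Sum>k\<le>S. g k * indicat_real {\<omega> \<in> space M. X i \<omega> = k} \<omega>"
  have ae: "AE \<omega> in M. ?f \<omega> = g (X i \<omega>)"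
    using AE_X_le[OF i] AE_space
  proof eventually_elim
    fix \<omega> assume "X i \<omega> \<le> S" "\<omega> \<in> space M"
    then have "?f \<omega> = (\<Sum>k\<le>S. if k = X i \<omega> then g k else 0)"
      by (intro sum.cong) (auto simp: indicator_def)
    with \<open>X i \<omega> \<le> S\<close> show "?f \<omega> = g (X i \<omega>)" by (simp add: sum.delta)
  qed
  have intf: "integrable M ?f"
    by (intro Bochner_Integration.integrable_sum integrable_mult_right)
       (simp add: X_event[OF i] emeasure_finite less_top[symmetric])
  have mf: "?f \<in> borel_measurable M" using intf by auto
  show "integrable M (\<lambda>\<omega>. g (X i \<omega>))"
    using integrable_cong_AE[OF mf fun_X_measurable[OF i] ae] intf by simp
  have "expectation (\<lambda>\<omega>. g (X i \<omega>)) = expectation ?f"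
    by (rule integral_cong_AE[symmetric, OF mf fun_X_measurable[OF i] ae])
  also have "\<dots> = (\<Sum>k\<le>S. g k * p0 k)"
    by (subst Bochner_Integration.integral_sum)
       (auto simp: X_event[OF i] emeasure_finite less_top[symmetric] distr[OF i])
  finally show "expectation (\<lambda>\<omega>. g (X i \<omega>)) = (\<Sum>k\<le>S. g k * p0 k)" .
qed

definition dev :: "nat \<Rightarrow> 'a \<Rightarrow> nat \<Rightarrow> real" where
  "dev n \<omega> k = sqrt (real n) * (emp_pmf X n \<omega> k - p0 k)"

text \<open>The centred summand for which a linear form in \<open>dev n\<close> becomes a sum over
  the sample divided by \<open>sqrt n\<close>. The cutoff reflects that the form does not see values
  above \<open>L\<close>.\<close>

definition score :: "nat \<Rightarrow> (nat \<Rightarrow> real) \<Rightarrow> nat \<Rightarrow> real" where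
  "score L a x = (if x \<le> L then a x else 0) - (\<Sum>k\<le>L. a k * p0 k)"

lemma linear_dev_eq:
  "(\<Sum>k\<le>L. a k * dev n \<omega> k) = (\<Sum>i<n. score L a (X (Suc i) \<omega>)) / sqrt (real n)"
proof (cases "n = 0")
  case True
  \<comment> \<open>For \<open>n = 0\<close> both sides are 0, because \<open>sqrt 0 = 0\<close> and
    division by 0 yields 0.\<close>
  then show ?thesis by (simp add: dev_def)
next
  case False
  have emp: "emp_pmf X n \<omega> k = (\<Sum>i<n. of_bool (X (Suc i) \<omega> = k)) / real n" for k
  proof -
    have "real (card {i\<in>{1..n}. X i \<omega> = k}) = (\<Sum>i\<in>{1..n}. of_bool (X i \<omega> = k))"
      by (simp add: of_bool_def sum.If_cases Int_def)
    also have "\<dots> = (\<Sum>i<n. of_bool (X (Suc i) \<omega> = k))"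
      by (rule sum.reindex_bij_witness[of _ Suc "\<lambda>i. i - 1"]) auto
    finally show ?thesis by (simp add: emp_pmf_def)
  qed
  have sc: "score L a x = (\<Sum>k\<le>L. a k * (of_bool (x = k) - p0 k))" for x
  proof -
    have "(\<Sum>k\<le>L. a k * of_bool (x = k)) = (\<Sum>k\<le>L. if k = x then a k else 0)"
      by (intro sum.cong) auto
    also have "\<dots> = (if x \<le> L then a x else 0)" by (simp add: sum.delta)
    finally show ?thesis by (simp add: score_def right_diff_distrib sum_subtractf)
  qed
  have "(\<Sum>i<n. score L a (X (Suc i) \<omega>)) = (\<Sum>k\<le>L. a k * (\<Sum>i<n. of_bool (X (Suc i) \<omega> = k) - p0 k))"
    unfolding sc sum_distrib_left by (rule sum.swap)
  also have "\<dots> = (\<Sum>k\<le>L. a k * (real n * (emp_pmf X n \<omega> k - p0 k)))"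
    using False by (intro sum.cong) (auto simp: emp sum_subtractf algebra_simps)
  also have "\<dots> = sqrt (real n) * (\<Sum>k\<le>L. a k * dev n \<omega> k)"
    unfolding sum_distrib_left dev_def by (intro sum.cong) (auto simp: algebra_simps real_sqrt_mult_self)
  finally show ?thesis using False by simp
qed

lemma sum_beyond: "L \<ge> S \<Longrightarrow> (\<Sum>k\<le>S. f k * p0 k) = (\<Sum>k\<le>L. f k * p0 k)"
  by (rule sum.mono_neutral_left) (auto simp: beyond)

lemma score_moments:
  assumes L: "L \<ge> S" and i: "i \<ge> 1"
  shows "expectation (\<lambda>\<omega>. score L a (X i \<omega>)) = 0"
    and "expectation (\<lambda>\<omega>. (score L a (X i \<omega>))^2) = linear_var p0 L a"
proof -
  define c where "c = (\<Sum>k\<le>L. a k * p0 k)"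
  have tot: "(\<Sum>k\<le>L. p0 k) = 1" using sum_beyond[OF L, of "\<lambda>_. 1"] total by simp
  have s: "score L a k = a k - c" if "k \<le> L" for k using that by (simp add: score_def c_def)
  have "expectation (\<lambda>\<omega>. score L a (X i \<omega>)) = (\<Sum>k\<le>L. score L a k * p0 k)"
    using expectation_fun_X[OF i] sum_beyond[OF L] by simp
  also have "\<dots> = (\<Sum>k\<le>L. a k * p0 k) - c * (\<Sum>k\<le>L. p0 k)"
    by (simp add: s left_diff_distrib sum_subtractf sum_distrib_left)
  finally show "expectation (\<lambda>\<omega>. score L a (X i \<omega>)) = 0" by (simp add: tot c_def)
  have "expectation (\<lambda>\<omega>. (score L a (X i \<omega>))^2) = (\<Sum>k\<le>L. (score L a k)^2 * p0 k)"
    using expectation_fun_X[OF i, of "\<lambda>x. (score L a x)^2"] sum_beyond[OF L] by simp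
  also have "\<dots> = (\<Sum>k\<le>L. (a k)^2 * p0 k) - 2 * c * (\<Sum>k\<le>L. a k * p0 k) + c^2 * (\<Sum>k\<le>L. p0 k)"
    by (simp add: s power2_eq_square algebra_simps sum_subtractf sum.distrib sum_distrib_left)
  finally show "expectation (\<lambda>\<omega>. (score L a (X i \<omega>))^2) = linear_var p0 L a"
    by (simp add: tot linear_var_def c_def[symmetric] power2_eq_square)
qed

text \<open>Moves the index set \<open>{1..}\<close> to all naturals, the form in which the central
  limit theorem takes its sequence; finite products are transported along
  \<open>Suc\<close>.\<close>

lemma indep_score: "indep_vars (\<lambda>_. borel) (\<lambda>i \<omega>. g (X (Suc i) \<omega>) :: real) UNIV"
proof -
  have "indep_vars (\<lambda>_. borel) (\<lambda>i \<omega>. g (X i \<omega>) :: real) {1..}"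
    by (rule indep_vars_compose2[OF indep]) auto
  then have mv: "\<And>i. i \<ge> 1 \<Longrightarrow> (\<lambda>\<omega>. g (X i \<omega>)) \<in> borel_measurable M"
    and ind: "indep_sets (\<lambda>i. {(\<lambda>\<omega>. g (X i \<omega>)) -` A \<inter> space M |A. A \<in> sets borel}) {1..}"
    by (auto simp: indep_vars_def2)
  let ?F = "\<lambda>i. {(\<lambda>\<omega>. g (X i \<omega>)) -` A \<inter> space M |A. A \<in> sets borel}"
  have "indep_sets (\<lambda>i. ?F (Suc i)) UNIV"
  proof (rule indep_setsI)
    show "?F (Suc i) \<subseteq> events" for i using mv[of "Suc i"] by (auto intro: measurable_sets)
    fix A J assume J: "J \<noteq> {}" "J \<subseteq> UNIV" "finite J" "\<forall>j\<in>J. A j \<in> ?F (Suc j)"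
    have "prob (\<Inter>i\<in>Suc ` J. A (i - 1)) = (\<Prod>i\<in>Suc ` J. prob (A (i - 1)))"
      by (rule indep_setsD[OF ind]) (use J in auto)
    then show "prob (\<Inter>j\<in>J. A j) = (\<Prod>j\<in>J. prob (A j))"
      by (simp add: prod.reindex)
  qed
  then show ?thesis using mv by (simp add: indep_vars_def2)
qed

text \<open>The newest score is independent of the partial sum before it and has mean 0, so the
  cross term vanishes.\<close>

lemma second_moment_sum:
  assumes L: "L \<ge> S"
  shows "integrable M (\<lambda>\<omega>. (\<Sum>i<n. score L a (X (Suc i) \<omega>))^2) \<and>
    expectation (\<lambda>\<omega>. (\<Sum>i<n. score L a (X (Suc i) \<omega>))^2) = real n * linear_var p0 L a"
proof (induction n)
  case (Suc n)
  let ?Z = "\<lambda>i \<omega>. score L a (X (Suc i) \<omega>)" and ?T = "\<lambda>\<omega>. \<Sum>i<n. score L a (X (Suc i) \<omega>)"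
  have "indep_var borel (?Z n) borel ?T"
    by (rule indep_vars_sum) (auto intro: indep_vars_subset[OF indep_score])
  note prod = indep_var_lebesgue_integral[OF this] indep_var_integrable[OF this]
  have iZ: "integrable M (?Z i)" for i by (rule integrable_fun_X) simp
  have iT: "integrable M ?T" using iZ by auto
  have iZ2: "integrable M (\<lambda>\<omega>. (?Z n \<omega>)^2)" by (rule integrable_fun_X) simp
  have iZT: "integrable M (\<lambda>\<omega>. ?Z n \<omega> * ?T \<omega>)" using prod iZ iT by auto
  have zero: "expectation (\<lambda>\<omega>. ?Z n \<omega> * ?T \<omega>) = 0"
    using prod(1)[OF iZ iT] score_moments[OF L, of "Suc n"] by simp
  have eq: "(\<Sum>i<Suc n. ?Z i \<omega>)^2 = (?T \<omega>)^2 + 2 * (?Z n \<omega> * ?T \<omega>) + (?Z n \<omega>)^2" for \<omega>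
    by (simp add: power2_eq_square algebra_simps)
  have "expectation (\<lambda>\<omega>. (\<Sum>i<Suc n. ?Z i \<omega>)^2) =
      expectation (\<lambda>\<omega>. (?T \<omega>)^2) + 2 * expectation (\<lambda>\<omega>. ?Z n \<omega> * ?T \<omega>) + expectation (\<lambda>\<omega>. (?Z n \<omega>)^2)"
    unfolding eq using Suc iZT iZ2 by simp
  moreover have "integrable M (\<lambda>\<omega>. (\<Sum>i<Suc n. ?Z i \<omega>)^2)"
    unfolding eq using Suc iZT iZ2 by auto
  ultimately show ?case
    using Suc zero score_moments(2)[OF L, of "Suc n" a] by (simp add: algebra_simps)
qed simp

lemma dev_eq_sum:
  assumes "k \<le> L"
  shows "dev n \<omega> k = (\<Sum>i<n. score L (\<lambda>j. of_bool (j = k)) (X (Suc i) \<omega>)) / sqrt (real n)"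
proof -
  have "(\<Sum>j\<le>L. of_bool (j = k) * dev n \<omega> j) = (\<Sum>j\<le>L. if j = k then dev n \<omega> j else 0)"
    by (intro sum.cong) auto
  also have "\<dots> = dev n \<omega> k" using assms by (simp add: sum.delta)
  finally show ?thesis by (simp add: linear_dev_eq)
qed

lemma dev_measurable: "(\<lambda>\<omega>. dev n \<omega> k) \<in> borel_measurable M"
  unfolding dev_eq_sum[OF order_refl]
  by (intro borel_measurable_divide borel_measurable_sum fun_X_measurable) auto

text \<open>The variance of an indicator is at most 1. The bound is uniform in \<open>n\<close> and
  \<open>k\<close>, which is what tightness and the control of \<open>inexact\<close> rest
  on.\<close>

lemma dev_second_moment:
  "integrable M (\<lambda>\<omega>. (dev n \<omega> k)^2) \<and> expectation (\<lambda>\<omega>. (dev n \<omega> k)^2) \<le> 1"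
proof -
  define L where "L = max S k"
  have L: "L \<ge> S" "k \<le> L" by (auto simp: L_def)
  define a :: "nat \<Rightarrow> real" where "a = (\<lambda>j. of_bool (j = k))"
  have "linear_var p0 L a \<le> (\<Sum>j\<le>L. (a j)^2 * p0 j)" by (simp add: linear_var_def)
  also have "\<dots> \<le> (\<Sum>j\<le>L. p0 j)" by (intro sum_mono) (simp add: a_def nonneg)
  also have "\<dots> = 1" using sum_beyond[OF L(1), of "\<lambda>_. 1"] total by simp
  finally have v: "linear_var p0 L a \<le> 1" .
  have eq: "(dev n \<omega> k)^2 = (\<Sum>i<n. score L a (X (Suc i) \<omega>))^2 / real n" for \<omega>
    by (simp add: dev_eq_sum[OF L(2)] a_def power_divide)
  have "real n * linear_var p0 L a / real n \<le> 1" using v by (cases "n = 0") auto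
  then show ?thesis unfolding eq using second_moment_sum[OF L(1), of a n] by simp
qed

lemma dev_sum_squares_tail:
  assumes c: "c > 0"
  shows "prob {\<omega> \<in> space M. (\<Sum>k\<le>L. (dev n \<omega> k)^2) \<ge> c} \<le> real (Suc L) / c"
proof -
  have int: "integrable M (\<lambda>\<omega>. \<Sum>k\<le>L. (dev n \<omega> k)^2)" using dev_second_moment by auto
  have "prob {\<omega> \<in> space M. (\<Sum>k\<le>L. (dev n \<omega> k)^2) \<ge> c} \<le> expectation (\<lambda>\<omega>. \<Sum>k\<le>L. (dev n \<omega> k)^2) / c"
    by (rule integral_Markov_inequality_measure[where A = "{}"]) (use int c in \<open>auto intro!: AE_I2 sum_nonneg\<close>)
  also have "expectation (\<lambda>\<omega>. \<Sum>k\<le>L. (dev n \<omega> k)^2) \<le> (\<Sum>k\<le>L. 1)"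
    using dev_second_moment by (subst Bochner_Integration.integral_sum) (auto intro!: sum_mono simp del: sum_constant)
  finally show ?thesis using c by (simp add: divide_right_mono)
qed

lemma dev_tight:
  assumes e: "e > 0"
  shows "\<exists>D. \<forall>n. prob {\<omega> \<in> space M. \<exists>k\<le>L. \<bar>dev n \<omega> k\<bar> > D} < e"
proof -
  \<comment> \<open>Makes the Markov bound equal to \<open>e / 2\<close>.\<close>
  define c where "c = 2 * real (Suc L) / e"
  have c: "c > 0" using e by (simp add: c_def)
  have "prob {\<omega> \<in> space M. \<exists>k\<le>L. \<bar>dev n \<omega> k\<bar> > sqrt c} < e" for n
  proof -
    have "prob {\<omega> \<in> space M. \<exists>k\<le>L. \<bar>dev n \<omega> k\<bar> > sqrt c} \<le>
        prob {\<omega> \<in> space M. (\<Sum>k\<le>L. (dev n \<omega> k)^2) \<ge> c}"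
    proof (rule finite_measure_mono)
      show "{\<omega> \<in> space M. \<exists>k\<le>L. \<bar>dev n \<omega> k\<bar> > sqrt c} \<subseteq> {\<omega> \<in> space M. (\<Sum>k\<le>L. (dev n \<omega> k)^2) \<ge> c}"
      proof safe
        fix \<omega> k assume k: "k \<le> L" "sqrt c < \<bar>dev n \<omega> k\<bar>"
        have "c \<le> (dev n \<omega> k)^2" using k(2) sqrt_le_D[of c "\<bar>dev n \<omega> k\<bar>"] by simp
        also have "\<dots> \<le> (\<Sum>k\<le>L. (dev n \<omega> k)^2)" by (rule member_le_sum) (use k in auto)
        finally show "c \<le> (\<Sum>k\<le>L. (dev n \<omega> k)^2)" .
      qed
      have [measurable]: "(\<lambda>\<omega>. dev n \<omega> k) \<in> borel_measurable M" for k by (rule dev_measurable)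
      show "{\<omega> \<in> space M. (\<Sum>k\<le>L. (dev n \<omega> k)^2) \<ge> c} \<in> events" by measurable
    qed
    also have "\<dots> \<le> real (Suc L) / c" by (rule dev_sum_squares_tail[OF c])
    also have "\<dots> = e / 2" using e by (simp add: c_def del: of_nat_Suc)
    also have "\<dots> < e" using e by simp
    finally show ?thesis .
  qed
  then show ?thesis by blast
qed

text \<open>For positive variance the scalar central limit theorem applies to the scores. For zero
  variance, as with \<open>a\<close> constant on the support, the scores vanish almost surely and no
  normalisation is possible, so this case is treated directly.\<close>

lemma linear_dev_limit:
  assumes L: "L \<ge> S"
  shows "(\<lambda>n. expectation (\<lambda>\<omega>. cos ((\<Sum>k\<le>L. a k * dev n \<omega> k) + b)))
     \<longlonglongrightarrow> exp (- linear_var p0 L a / 2) * cos b"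
proof -
  let ?Z = "\<lambda>i \<omega>. score L a (X (Suc i) \<omega>)"
  let ?T = "\<lambda>n \<omega>. \<Sum>i<n. score L a (X (Suc i) \<omega>)"
  have Zm [measurable]: "?Z i \<in> borel_measurable M" for i by (rule fun_X_measurable) simp
  have sq: "expectation (\<lambda>\<omega>. (?Z i \<omega>)^2) = linear_var p0 L a" for i
    by (rule score_moments[OF L]) simp
  have "linear_var p0 L a = expectation (\<lambda>\<omega>. (?Z 0 \<omega>)^2)" using sq by simp
  then have v0: "linear_var p0 L a \<ge> 0" by simp
  show ?thesis
  proof (cases "linear_var p0 L a = 0")
    case True
    have "AE \<omega> in M. (?Z i \<omega>)^2 = 0" for i
    proof -
      have "integrable M (\<lambda>\<omega>. (?Z i \<omega>)^2)" by (rule integrable_fun_X) simp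
      from integral_nonneg_eq_0_iff_AE[OF this] show ?thesis using sq[of i] True by simp
    qed
    then have ae: "AE \<omega> in M. \<forall>i. ?Z i \<omega> = 0" by (simp add: AE_all_countable)
    have "expectation (\<lambda>\<omega>. cos ((\<Sum>k\<le>L. a k * dev n \<omega> k) + b)) = expectation (\<lambda>\<omega>. cos b)" for n
    proof (rule integral_cong_AE)
      have [measurable]: "(\<lambda>\<omega>. dev n \<omega> k) \<in> borel_measurable M" for k by (rule dev_measurable)
      show "(\<lambda>\<omega>. cos ((\<Sum>k\<le>L. a k * dev n \<omega> k) + b)) \<in> borel_measurable M" by measurable
      show "AE \<omega> in M. cos ((\<Sum>k\<le>L. a k * dev n \<omega> k) + b) = cos b"
        using ae by eventually_elim (simp add: linear_dev_eq)
    qed simp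
    then show ?thesis using True by (simp add: prob_space)
  next
    case False
    define \<sigma> where "\<sigma> = sqrt (linear_var p0 L a)"
    have \<sigma>: "\<sigma> > 0" "\<sigma>^2 = linear_var p0 L a" using v0 False by (auto simp: \<sigma>_def)
    have mean: "expectation (?Z i) = 0" for i by (rule score_moments[OF L]) simp
    \<comment> \<open>Equality of laws is derived from the point masses: the probability of any
      event for a score is a finite sum of values of \<open>p0\<close>.\<close>
    have same: "distr M borel (?Z i) = distr M borel (?Z 0)" for i
    proof (rule measure_eqI)
      fix A :: "real set" assume "A \<in> sets (distr M borel (?Z i))"
      then have A: "A \<in> sets borel" by simp
      have pr: "measure (distr M borel (?Z i)) A = (\<Sum>k\<le>S. indicator A (score L a k) * p0 k)" for i
      proof -
        have "measure (distr M borel (?Z i)) A = prob (?Z i -` A \<inter> space M)"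
          using A by (simp add: measure_distr)
        also have "\<dots> = expectation (indicator (?Z i -` A \<inter> space M))" by simp
        also have "\<dots> = expectation (\<lambda>\<omega>. indicator A (score L a (X (Suc i) \<omega>)))"
          by (rule Bochner_Integration.integral_cong) (auto simp: indicator_def)
        also have "\<dots> = (\<Sum>k\<le>S. indicator A (score L a k) * p0 k)"
          by (rule expectation_fun_X) simp
        finally show ?thesis .
      qed
      interpret D: prob_space "distr M borel (?Z i)" for i by (rule prob_space_distr) simp
      show "emeasure (distr M borel (?Z i)) A = emeasure (distr M borel (?Z 0)) A"
        by (simp add: D.emeasure_eq_measure pr)
    qed simp
    have "weak_conv_m (\<lambda>n. distr M borel (\<lambda>\<omega>. ?T n \<omega> / sqrt (real n * \<sigma>\<^sup>2))) std_normal_distribution"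
    proof (rule central_limit_theorem_zero_mean[OF indep_score mean \<sigma>(1) _ _ same])
      show "integrable M (\<lambda>\<omega>. (?Z i \<omega>)^2)" for i by (rule integrable_fun_X) simp
      show "variance (?Z i) = \<sigma>\<^sup>2" for i using mean[of i] sq[of i] \<sigma>(2) by simp
    qed
    \<comment> \<open>Evaluating at \<open>\<sigma>\<close> undoes the division by the standard
      deviation.\<close>
    then have "(\<lambda>n. char (distr M borel (\<lambda>\<omega>. ?T n \<omega> / sqrt (real n * \<sigma>\<^sup>2))) \<sigma>)
        \<longlonglongrightarrow> char std_normal_distribution \<sigma>"
      by (intro levy_continuity1) (auto intro!: real_distribution_distr real_dist_normal_dist)
    moreover have "char (distr M borel (\<lambda>\<omega>. ?T n \<omega> / sqrt (real n * \<sigma>\<^sup>2))) \<sigma>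
        = (\<integral>\<omega>. cis (\<Sum>k\<le>L. a k * dev n \<omega> k) \<partial>M)" for n
    proof -
      have "\<sigma> * (?T n \<omega> / sqrt (real n * \<sigma>\<^sup>2)) = (\<Sum>k\<le>L. a k * dev n \<omega> k)" for \<omega>
        using \<sigma>(1) by (simp add: linear_dev_eq real_sqrt_mult)
      then show ?thesis
        unfolding char_def by (subst integral_distr) (auto simp: cis_conv_exp)
    qed
    ultimately have "(\<lambda>n. \<integral>\<omega>. cis (\<Sum>k\<le>L. a k * dev n \<omega> k) \<partial>M)
       \<longlonglongrightarrow> complex_of_real (exp (- linear_var p0 L a / 2))"
      by (simp add: char_std_normal_distribution \<sigma>(2))
    then have "(\<lambda>n. Re (cis b * (\<integral>\<omega>. cis (\<Sum>k\<le>L. a k * dev n \<omega> k) \<partial>M)))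
       \<longlonglongrightarrow> Re (cis b * complex_of_real (exp (- linear_var p0 L a / 2)))"
      by (intro tendsto_Re tendsto_mult_left)
    moreover have "(\<lambda>\<omega>. \<Sum>k\<le>L. a k * dev n \<omega> k) \<in> borel_measurable M" for n
      using dev_measurable by auto
    ultimately show ?thesis by (simp add: expectation_cos_shift mult.commute)
  qed
qed

end

section \<open>Characteristic function of the Brownian bridge increments\<close>

text \<open>Abel summation passes from increments to values of \<open>u\<close> at the points
  \<open>Fseq p i\<close>, the form in which the laws of the bridge are given.\<close>

lemma Wvec_abel_sum:
  assumes "u 0 = 0"
  shows "(\<Sum>k\<le>L. a k * Wvec p u k) =
    (\<Sum>i<Suc L. (a i - (if i < L then a (Suc i) else 0)) * u (Fseq p i))"
proof -
  \<comment> \<open>The boundary term makes the induction go through; below, the identity is applied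
    to \<open>a\<close> cut off beyond \<open>L\<close>, where that term is 0.\<close>
  have gen: "(\<Sum>k\<le>L. a k * Wvec p u k) =
     (\<Sum>i<Suc L. (a i - a (Suc i)) * u (Fseq p i)) + a (Suc L) * u (Fseq p L)" for a
    by (induction L) (simp_all add: Wvec_def assms algebra_simps)
  have "(\<Sum>k\<le>L. a k * Wvec p u k) = (\<Sum>k\<le>L. (if k \<le> L then a k else 0) * Wvec p u k)"
    by (intro sum.cong) auto
  also have "\<dots> = (\<Sum>i<Suc L. (a i - (if i < L then a (Suc i) else 0)) * u (Fseq p i))"
    unfolding gen by (simp add: lessThan_Suc_atMost) (intro sum.cong, auto)
  finally show ?thesis .
qed

text \<open>\<open>Fseq p i\<close> is the sum of \<open>p k\<close> over \<open>k \<le> i\<close>,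
  and by monotonicity the minimum of two values is \<open>Fseq p (min i j)\<close>. Hence the sums
  split over \<open>k\<close>, and the sum of \<open>b i\<close> over \<open>i \<ge> k\<close>
  telescopes back to \<open>a k\<close>.\<close>

lemma bridge_covariance_sum:
  assumes nonneg: "\<And>k. p k \<ge> 0"
    and b: "\<And>i. b i = a i - (if i < L then a (Suc i) else 0)"
  shows "(\<Sum>i<Suc L. \<Sum>j<Suc L. b i * b j * (min (Fseq p i) (Fseq p j) - Fseq p i * Fseq p j))
    = linear_var p L a"
proof -
  define I where "I k i = (of_bool (k \<le> i) :: real)" for k i :: nat
  have F: "Fseq p i = (\<Sum>k\<le>L. p k * I k i)" if "i \<le> L" for i
  proof -
    have "Fseq p i = (\<Sum>k\<le>i. p k * I k i)" by (simp add: Fseq_def I_def)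
    also have "\<dots> = (\<Sum>k\<le>L. p k * I k i)"
      by (rule sum.mono_neutral_left) (use that in \<open>auto simp: I_def\<close>)
    finally show ?thesis .
  qed
  have mono: "Fseq p i \<le> Fseq p j" if "i \<le> j" for i j
    unfolding Fseq_def by (rule sum_mono2) (use that nonneg in auto)
  have minF: "min (Fseq p i) (Fseq p j) = (\<Sum>k\<le>L. p k * (I k i * I k j))" if "i \<le> L" "j \<le> L" for i j
  proof -
    have "min (Fseq p i) (Fseq p j) = Fseq p (min i j)"
      using mono[of i j] mono[of j i] by (cases "i \<le> j") (auto simp: min_def)
    also have "\<dots> = (\<Sum>k\<le>L. p k * I k (min i j))" using that by (intro F) auto
    also have "\<dots> = (\<Sum>k\<le>L. p k * (I k i * I k j))" by (intro sum.cong) (auto simp: I_def)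
    finally show ?thesis .
  qed
  have T: "(\<Sum>i\<le>L. b i * I k i) = a k" if "k \<le> L" for k
  proof -
    define a' where "a' i = (if i \<le> L then a i else 0)" for i
    have "(\<Sum>i\<le>L. b i * I k i) = (\<Sum>i\<in>{k..L}. b i)"
      by (rule sum.mono_neutral_cong_right) (auto simp: I_def)
    also have "\<dots> = - (\<Sum>i=k..L. a' (Suc i) - a' i)"
      unfolding sum_negf[symmetric] by (rule sum.cong) (auto simp: b a'_def)
    also have "\<dots> = a k" using that by (subst sum_Suc_diff) (auto simp: a'_def)
    finally show ?thesis .
  qed
  have "(\<Sum>i\<le>L. \<Sum>j\<le>L. b i * b j * min (Fseq p i) (Fseq p j)) =
     (\<Sum>i\<le>L. \<Sum>j\<le>L. \<Sum>k\<le>L. p k * ((b i * I k i) * (b j * I k j)))"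
    by (intro sum.cong refl) (simp add: minF sum_distrib_left algebra_simps)
  also have "\<dots> = (\<Sum>i\<le>L. \<Sum>k\<le>L. \<Sum>j\<le>L. p k * ((b i * I k i) * (b j * I k j)))"
    by (intro sum.cong refl sum.swap)
  also have "\<dots> = (\<Sum>k\<le>L. \<Sum>i\<le>L. \<Sum>j\<le>L. p k * ((b i * I k i) * (b j * I k j)))"
    by (rule sum.swap)
  also have "\<dots> = (\<Sum>k\<le>L. p k * ((\<Sum>i\<le>L. b i * I k i) * (\<Sum>j\<le>L. b j * I k j)))"
    by (intro sum.cong refl) (subst sum_product, simp only: sum_distrib_left)
  also have "\<dots> = (\<Sum>k\<le>L. (a k)^2 * p k)"
    by (intro sum.cong refl) (simp add: T power2_eq_square)
  finally have 1: "(\<Sum>i\<le>L. \<Sum>j\<le>L. b i * b j * min (Fseq p i) (Fseq p j)) = (\<Sum>k\<le>L. (a k)^2 * p k)" .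
  have "(\<Sum>i\<le>L. b i * Fseq p i) = (\<Sum>i\<le>L. \<Sum>k\<le>L. p k * (b i * I k i))"
    by (intro sum.cong refl) (simp add: F sum_distrib_left algebra_simps)
  also have "\<dots> = (\<Sum>k\<le>L. \<Sum>i\<le>L. p k * (b i * I k i))" by (rule sum.swap)
  also have "\<dots> = (\<Sum>k\<le>L. a k * p k)"
    by (intro sum.cong refl) (simp add: sum_distrib_left[symmetric] T)
  finally have 2: "(\<Sum>i\<le>L. b i * Fseq p i) = (\<Sum>k\<le>L. a k * p k)" .
  have "(\<Sum>i\<le>L. \<Sum>j\<le>L. b i * b j * (Fseq p i * Fseq p j)) = (\<Sum>i\<le>L. b i * Fseq p i)^2"
    unfolding power2_eq_square sum_product by (intro sum.cong refl) (simp add: algebra_simps)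
  with 1 2 show ?thesis
    by (simp add: linear_var_def lessThan_Suc_atMost right_diff_distrib sum_subtractf)
qed

lemma Fseq_bounds:
  assumes "\<And>k. p k \<ge> 0" "(\<Sum>k\<le>S. p k) = 1" "\<And>k. k > S \<Longrightarrow> p k = 0"
  shows "0 \<le> Fseq p k" "Fseq p k \<le> 1"
proof -
  show "0 \<le> Fseq p k" using assms(1) by (simp add: Fseq_def sum_nonneg)
  have "Fseq p k \<le> (\<Sum>j\<le>max k S. p j)"
    unfolding Fseq_def by (rule sum_mono2) (use assms(1) in auto)
  also have "\<dots> = (\<Sum>j\<le>S. p j)"
    by (rule sum.mono_neutral_right) (use assms(3) in auto)
  finally show "Fseq p k \<le> 1" using assms(2) by simp
qed

lemma Wvec_bridge_measurable:
  assumes U: "brownian_bridge N U"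
    and p: "\<And>k. p k \<ge> 0" "(\<Sum>k\<le>S. p k) = 1" "\<And>k. k > S \<Longrightarrow> p k = 0"
  shows "(\<lambda>\<omega>. Wvec p (U \<omega>) k) \<in> borel_measurable N"
proof -
  have "(\<lambda>\<omega>. U \<omega> t) \<in> borel_measurable N" if "0 \<le> t" "t \<le> 1" for t
    using U that by (simp add: brownian_bridge_def)
  then show ?thesis
    unfolding Wvec_def using Fseq_bounds[OF p] by (cases "k = 0") auto
qed

lemma linear_bridge_expectation:
  assumes U: "brownian_bridge N U"
    and p: "\<And>k. p k \<ge> 0" "(\<Sum>k\<le>S. p k) = 1" "\<And>k. k > S \<Longrightarrow> p k = 0"
  shows "(\<integral>\<omega>. cos ((\<Sum>k\<le>L. a k * Wvec p (U \<omega>) k) + b) \<partial>N) = exp (- linear_var p L a / 2) * cos b"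
proof -
  interpret N: prob_space N using U by (simp add: brownian_bridge_def)
  define c where "c i = a i - (if i < L then a (Suc i) else 0)" for i
  have meas: "(\<lambda>\<omega>. \<Sum>k\<le>L. a k * Wvec p (U \<omega>) k) \<in> borel_measurable N"
    using Wvec_bridge_measurable[OF U p] by auto
  have "(\<integral>\<omega>. cis (\<Sum>k\<le>L. a k * Wvec p (U \<omega>) k) \<partial>N) = (\<integral>\<omega>. cis (\<Sum>i<Suc L. c i * U \<omega> (Fseq p i)) \<partial>N)"
  proof (rule Bochner_Integration.integral_cong[OF refl])
    fix \<omega> assume "\<omega> \<in> space N"
    then have "U \<omega> 0 = 0" using U by (simp add: brownian_bridge_def)
    then show "cis (\<Sum>k\<le>L. a k * Wvec p (U \<omega>) k) = cis (\<Sum>i<Suc L. c i * U \<omega> (Fseq p i))"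
      unfolding c_def by (subst Wvec_abel_sum) auto
  qed
  also have "\<dots> = complex_of_real (exp (- (1/2) *
      (\<Sum>i<Suc L. \<Sum>j<Suc L. c i * c j * (min (Fseq p i) (Fseq p j) - Fseq p i * Fseq p j))))"
  proof -
    have "\<forall>i<Suc L. 0 \<le> Fseq p i \<and> Fseq p i \<le> 1" using Fseq_bounds[OF p] by auto
    with U show ?thesis unfolding brownian_bridge_def by blast
  qed
  also have "\<dots> = complex_of_real (exp (- linear_var p L a / 2))"
    by (subst bridge_covariance_sum[OF p(1) c_def]) simp
  finally show ?thesis by (simp add: N.expectation_cos_shift[OF meas] mult.commute)
qed

lemma sum_Wvec: "u 0 = 0 \<Longrightarrow> (\<Sum>k\<le>s. Wvec p u k) = u (Fseq p s)"
  by (induction s) (simp_all add: Wvec_def)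

section \<open>The cones of the limit problems and the exact form of the estimator\<close>

text \<open>The common shape of both cones: homogeneous weak inequalities at selected indices, hence
  closed and stable under sums and nonnegative multiples.\<close>

lemma vec_cone_Dlt: "vec_cone {g \<in> vecs n. \<forall>k. P k \<longrightarrow> Dlt g k \<ge> 0} n"
proof
  show "closed {g \<in> vecs n. \<forall>k. P k \<longrightarrow> Dlt g k \<ge> 0}"
    unfolding vecs_def Dlt_def mem_Collect_eq
    by (intro closed_Collect_conj closed_Collect_all closed_Collect_imp closed_Collect_eq
        closed_Collect_le open_Collect_const continuous_intros continuous_on_product_coordinates)
  show "(\<lambda>k. g k + h k) \<in> {g \<in> vecs n. \<forall>k. P k \<longrightarrow> Dlt g k \<ge> 0}"
    if "g \<in> {g \<in> vecs n. \<forall>k. P k \<longrightarrow> Dlt g k \<ge> 0}" "h \<in> {g \<in> vecs n. \<forall>k. P k \<longrightarrow> Dlt g k \<ge> 0}" for g h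
  proof -
    have "Dlt (\<lambda>k. g k + h k) k = Dlt g k + Dlt h k" for k by (simp add: Dlt_def algebra_simps)
    with that show ?thesis by (auto simp: vecs_def)
  qed
  show "(\<lambda>k. c * g k) \<in> {g \<in> vecs n. \<forall>k. P k \<longrightarrow> Dlt g k \<ge> 0}"
    if "g \<in> {g \<in> vecs n. \<forall>k. P k \<longrightarrow> Dlt g k \<ge> 0}" "0 \<le> c" for g c
  proof -
    have "Dlt (\<lambda>k. c * g k) k = c * Dlt g k" for k by (simp add: Dlt_def algebra_simps)
    with that show ?thesis by (auto simp: vecs_def)
  qed
qed (auto simp: vecs_def Dlt_def)

text \<open>An index outside \<open>B\<close> lies strictly between its two neighbours in
  \<open>B\<close>, and \<open>m \<in> B\<close> keeps the right neighbour at most \<open>m\<close>.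
  Conversely, a gap between consecutive points contains no point of \<open>B\<close>.\<close>

lemma convex_between_consec_iff:
  assumes B: "finite B" "0 \<in> B" "m \<in> B"
  shows "(\<forall>a b. consec B a b \<and> b \<le> m \<longrightarrow> convex_between g a b) \<longleftrightarrow>
    (\<forall>k. 0 < k \<and> k < m \<and> k \<notin> B \<longrightarrow> Dlt g k \<ge> 0)"
proof safe
  fix k assume L: "\<forall>a b. consec B a b \<and> b \<le> m \<longrightarrow> convex_between g a b" and k: "0 < k" "k < m" "k \<notin> B"
  define a where "a = Max {x\<in>B. x < k}"
  define b where "b = Min {x\<in>B. k < x}"
  have a: "a \<in> {x\<in>B. x < k}" unfolding a_def by (rule Max_in) (use B k in auto)
  have b: "b \<in> {x\<in>B. k < x}" unfolding b_def by (rule Min_in) (use B k in auto)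
  have amax: "x \<le> a" if "x \<in> B" "x < k" for x unfolding a_def by (rule Max_ge) (use B that in auto)
  have bmin: "b \<le> x" if "x \<in> B" "k < x" for x unfolding b_def by (rule Min_le) (use B that in auto)
  have "consec B a b" unfolding consec_def using a b amax bmin k(3)
    by (auto simp: not_less) (metis linorder_neqE_nat not_less)
  moreover have "b \<le> m" using bmin B k by auto
  ultimately have "convex_between g a b" using L by blast
  then show "Dlt g k \<ge> 0" using a b by (auto simp: convex_between_def Dlt_def)
next
  fix a b assume R: "\<forall>k. 0 < k \<and> k < m \<and> k \<notin> B \<longrightarrow> Dlt g k \<ge> 0" and ab: "consec B a b" "b \<le> m"
  show "convex_between g a b" unfolding convex_between_def
  proof safe
    fix k assume "a < k" "k < b"
    with ab have "0 < k \<and> k < m \<and> k \<notin> B" by (auto simp: consec_def)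
    with R show "0 \<le> g (k + 1) - 2 * g k + g (k - 1)" by (auto simp: Dlt_def)
  qed
qed

lemma finite_breakpoints: "finite (breakpoints p S)"
proof -
  have "breakpoints p S \<subseteq> {..S+1}" by (auto simp: breakpoints_def)
  then show ?thesis by (rule finite_subset) simp
qed

lemma CK_eq: "CK p S = {g \<in> vecs (S + 1). \<forall>k. 0 < k \<and> k \<le> S \<and> \<not> is_knot p k \<longrightarrow> Dlt g k \<ge> 0}"
proof -
  have le: "b \<le> S + 1" if "consec (breakpoints p S) a b" for a b
    using that by (auto simp: consec_def breakpoints_def)
  have "(\<forall>a b. consec (breakpoints p S) a b \<longrightarrow> convex_between g a b) \<longleftrightarrow>
      (\<forall>k. 0 < k \<and> k < S + 1 \<and> k \<notin> breakpoints p S \<longrightarrow> Dlt g k \<ge> 0)" for g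
    using le by (subst convex_between_consec_iff[symmetric, OF finite_breakpoints])
      (auto simp: breakpoints_def)
  moreover have "(0 < k \<and> k < S + 1 \<and> k \<notin> breakpoints p S) \<longleftrightarrow> (0 < k \<and> k \<le> S \<and> \<not> is_knot p k)" for k
    by (auto simp: breakpoints_def)
  ultimately show ?thesis by (simp add: CK_def)
qed

lemma CKle_eq:
  assumes "s \<le> S" "is_knot p s"
  shows "CKle p S s = {g \<in> vecs s. \<forall>k. 0 < k \<and> k < s \<and> \<not> is_knot p k \<longrightarrow> Dlt g k \<ge> 0}"
proof -
  have "1 \<le> s" using assms(2) by (simp add: is_knot_def)
  then have "(\<forall>a b. consec (breakpoints p S) a b \<and> b \<le> s \<longrightarrow> convex_between g a b) \<longleftrightarrow>
      (\<forall>k. 0 < k \<and> k < s \<and> k \<notin> breakpoints p S \<longrightarrow> Dlt g k \<ge> 0)" for g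
    using assms by (intro convex_between_consec_iff[OF finite_breakpoints]) (auto simp: breakpoints_def)
  moreover have "(0 < k \<and> k < s \<and> k \<notin> breakpoints p S) \<longleftrightarrow> (0 < k \<and> k < s \<and> \<not> is_knot p k)" for k
    using assms(1) by (auto simp: breakpoints_def)
  ultimately show ?thesis by (simp add: CKle_def)
qed

lemma vec_cone_CK: "vec_cone (CK p S) (S + 1)"
  unfolding CK_eq by (rule vec_cone_Dlt)

lemma vec_cone_CKle: "s \<le> S \<Longrightarrow> is_knot p s \<Longrightarrow> vec_cone (CKle p S s) s"
  by (simp only: CKle_eq) (rule vec_cone_Dlt)

lemma ghat_eq: "ghat p S u = lsq_proj (CK p S) (S + 1) (Wvec p u)"
  by (simp add: ghat_def lsq_proj_def Phi_full_def)

lemma gle_eq: "gle p S s u = lsq_proj (CKle p S s) s (Wvec p u)"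
  by (simp add: gle_def lsq_proj_def Phi_le_def)

section \<open>Test directions for the projections, and restriction at a knot\<close>

lemma proj_CK_last_ge:
  "w (S + 1) \<le> lsq_proj (CK p S) (S + 1) w (S + 1)"
proof -
  interpret vec_cone "CK p S" "S + 1" by (rule vec_cone_CK)
  let ?g = "lsq_proj (CK p S) (S + 1) w"
  have "(\<lambda>k. of_bool (k = S + 1)) \<in> CK p S" by (auto simp: CK_eq vecs_def Dlt_def)
  then have "(\<Sum>k\<le>S+1. (w k - ?g k) * of_bool (k = S + 1)) \<le> 0"
    using lsq_proj_is_proj[of w] by (simp only: is_proj_def)
  then show ?thesis by simp
qed

text \<open>The indicator of \<open>{0..s}\<close> has its only negative second difference at
  \<open>s\<close>, and the cone imposes nothing at a knot.\<close>

lemma proj_CK_sum_ge: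
  assumes "s \<le> S" "is_knot p s"
  shows "(\<Sum>k\<le>s. w k) \<le> (\<Sum>k\<le>s. lsq_proj (CK p S) (S + 1) w k)"
proof -
  interpret vec_cone "CK p S" "S + 1" by (rule vec_cone_CK)
  let ?g = "lsq_proj (CK p S) (S + 1) w"
  have "Dlt (\<lambda>k. of_bool (k \<le> s)) k \<ge> (0::real)" if "\<not> is_knot p k" for k
  proof -
    have "k \<noteq> s" using that assms(2) by auto
    then show ?thesis by (auto simp: Dlt_def)
  qed
  then have "(\<lambda>k. of_bool (k \<le> s)) \<in> CK p S" using assms(1) by (auto simp: CK_eq vecs_def)
  then have "(\<Sum>k\<le>S+1. (w k - ?g k) * of_bool (k \<le> s)) \<le> 0"
    using lsq_proj_is_proj[of w] by (simp only: is_proj_def)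
  also have "(\<Sum>k\<le>S+1. (w k - ?g k) * of_bool (k \<le> s)) = (\<Sum>k\<le>s. w k - ?g k)"
    by (rule sum.mono_neutral_cong_right) (use assms(1) in auto)
  finally show ?thesis by (simp add: sum_subtractf)
qed

text \<open>When a direction and its negative are both feasible, the residual is orthogonal to it;
  here the direction is the constant vector.\<close>

lemma is_proj_sum_eq:
  assumes "vec_cone K n" "(\<lambda>k. of_bool (k \<le> n)) \<in> K" "(\<lambda>k. - of_bool (k \<le> n)) \<in> K"
  shows "(\<Sum>k\<le>n. lsq_proj K n w k) = (\<Sum>k\<le>n. w k)"
proof -
  interpret vec_cone K n by fact
  let ?g = "lsq_proj K n w"
  have le: "(\<Sum>k\<le>n. (w k - ?g k) * h k) \<le> 0" if "h \<in> K" for h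
    using lsq_proj_is_proj[of w] that unfolding is_proj_def by blast
  show ?thesis using le[OF assms(2)] le[OF assms(3)] by (simp add: sum_subtractf)
qed

lemma proj_CK_total: "(\<Sum>k\<le>S+1. lsq_proj (CK p S) (S + 1) w k) = (\<Sum>k\<le>S+1. w k)"
  by (rule is_proj_sum_eq[OF vec_cone_CK]) (auto simp: CK_eq vecs_def Dlt_def)

text \<open>The constraints stop at \<open>k < s\<close>, so the drop of the constant vector to 0
  after \<open>s\<close> is not seen.\<close>

lemma proj_CKle_total:
  assumes "s \<le> S" "is_knot p s"
  shows "(\<Sum>k\<le>s. lsq_proj (CKle p S s) s w k) = (\<Sum>k\<le>s. w k)"
  by (rule is_proj_sum_eq[OF vec_cone_CKle[OF assms]])
     (auto simp: CKle_eq[OF assms] vecs_def Dlt_def)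

text \<open>The splice is shifted to be continuous at the knot $s$, where no convexity is required.\<close>

lemma glue_CK:
  assumes s: "s \<le> S" "is_knot p s" and h: "h \<in> CKle p S s" and g: "g \<in> CK p S"
  shows "(\<lambda>k. if k \<le> s then h k else if k \<le> S + 1 then g k - g s + h s else 0) \<in> CK p S"
    (is "?f \<in> _")
proof -
  have "Dlt ?f k \<ge> 0" if k: "0 < k" "k \<le> S" "\<not> is_knot p k" for k
  proof -
    have "k \<noteq> s" using k s(2) by auto
    then consider "k < s" | "s < k" by linarith
    then show ?thesis
    proof cases
      case 1
      then have "k - 1 \<le> s" by simp
      with 1 have "Dlt ?f k = Dlt h k" by (simp add: Dlt_def)
      with h 1 k show ?thesis by (auto simp: CKle_eq[OF s])
    next
      case 2
      have "?f (k - 1) = g (k - 1) - g s + h s" using 2 k by (cases "k - 1 = s") auto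
      then have "Dlt ?f k = Dlt g k" using 2 k by (simp add: Dlt_def)
      with g k show ?thesis by (auto simp: CK_eq)
    qed
  qed
  then show ?thesis using s(1) by (auto simp: CK_eq vecs_def)
qed

text \<open>Necessity: projection onto the smaller cone preserves the total. Sufficiency: the
  residuals right of \<open>s\<close> then also sum to 0, so the vertical shift in the splice
  contributes nothing and the variational inequality splits into a left and a right part.\<close>

lemma restriction_eq_proj_iff:
  assumes s: "s \<le> S" "is_knot p s"
  shows "lsq_proj (CKle p S s) s w = (\<lambda>k. if k \<le> s then lsq_proj (CK p S) (S + 1) w k else 0)
    \<longleftrightarrow> (\<Sum>k\<le>s. lsq_proj (CK p S) (S + 1) w k) = (\<Sum>k\<le>s. w k)" (is "?l = ?r \<longleftrightarrow> _")
proof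
  assume "?l = ?r"
  then have "(\<Sum>k\<le>s. ?l k) = (\<Sum>k\<le>s. lsq_proj (CK p S) (S + 1) w k)" by simp
  then show "(\<Sum>k\<le>s. lsq_proj (CK p S) (S + 1) w k) = (\<Sum>k\<le>s. w k)"
    by (simp add: proj_CKle_total[OF s])
next
  assume eq: "(\<Sum>k\<le>s. lsq_proj (CK p S) (S + 1) w k) = (\<Sum>k\<le>s. w k)"
  interpret K: vec_cone "CK p S" "S + 1" by (rule vec_cone_CK)
  interpret Ks: vec_cone "CKle p S s" s by (rule vec_cone_CKle[OF s])
  define g where "g = lsq_proj (CK p S) (S + 1) w"
  have g: "g \<in> CK p S" "\<And>h. h \<in> CK p S \<Longrightarrow> (\<Sum>k\<le>S+1. (w k - g k) * h k) \<le> 0"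
    "(\<Sum>k\<le>S+1. (w k - g k) * g k) = 0"
    using K.lsq_proj_is_proj[of w] unfolding g_def K.is_proj_def by blast+
  have split: "(\<Sum>k\<le>S+1. f k) = (\<Sum>k\<le>s. f k) + (\<Sum>k\<in>{s<..S+1}. f k)" for f :: "nat \<Rightarrow> real"
  proof -
    have "{..S+1} = {..s} \<union> {s<..S+1}" using s(1) by auto
    then show ?thesis by (simp only:) (rule sum.union_disjoint, auto)
  qed
  have tail: "(\<Sum>k\<in>{s<..S+1}. w k - g k) = 0"
    using proj_CK_total[where p = p and S = S and w = w] eq split[of "\<lambda>k. w k - g k"]
    by (simp add: sum_subtractf g_def)
  have glued: "(\<Sum>k\<le>s. (w k - g k) * h k) + (\<Sum>k\<in>{s<..S+1}. (w k - g k) * f k) \<le> 0"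
    if h: "h \<in> CKle p S s" and f: "f \<in> CK p S" for h f
  proof -
    let ?f = "\<lambda>k. if k \<le> s then h k else if k \<le> S + 1 then f k - f s + h s else 0"
    have "(\<Sum>k\<le>S+1. (w k - g k) * ?f k) \<le> 0" by (rule g(2)[OF glue_CK[OF s h f]])
    also have "(\<Sum>k\<le>S+1. (w k - g k) * ?f k) =
        (\<Sum>k\<le>s. (w k - g k) * h k) + (\<Sum>k\<in>{s<..S+1}. (w k - g k) * (f k + (h s - f s)))"
      unfolding split by (intro arg_cong2[where f = "(+)"] sum.cong) auto
    also have "(\<Sum>k\<in>{s<..S+1}. (w k - g k) * (f k + (h s - f s))) =
        (\<Sum>k\<in>{s<..S+1}. (w k - g k) * f k) + (\<Sum>k\<in>{s<..S+1}. w k - g k) * (h s - f s)"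
      by (simp only: distrib_left sum.distrib sum_distrib_right)
    finally show ?thesis unfolding tail by simp
  qed
  have gs: "(\<lambda>k. if k \<le> s then g k else 0) \<in> CKle p S s"
  proof -
    have "Dlt (\<lambda>k. if k \<le> s then g k else 0) k = Dlt g k" if "k < s" for k
      using that by (simp add: Dlt_def)
    with g(1) s show ?thesis by (auto simp: CKle_eq[OF s] CK_eq vecs_def)
  qed
  have "Ks.is_proj w (\<lambda>k. if k \<le> s then g k else 0)"
    unfolding Ks.is_proj_def
  proof (intro conjI ballI gs)
    show "(\<Sum>k\<le>s. (w k - (if k \<le> s then g k else 0)) * h k) \<le> 0" if "h \<in> CKle p S s" for h
      using glued[OF that K.zero] by simp
    \<comment> \<open>The left and right parts of the orthogonality relation are each at most 0 and
      add up to 0, so both are 0.\<close>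
    have "(\<Sum>k\<le>s. (w k - g k) * g k) \<le> 0" using glued[OF gs K.zero] by simp
    moreover have "(\<Sum>k\<in>{s<..S+1}. (w k - g k) * g k) \<le> 0" using glued[OF Ks.zero g(1)] by simp
    ultimately show "(\<Sum>k\<le>s. (w k - (if k \<le> s then g k else 0)) * (if k \<le> s then g k else 0)) = 0"
      using g(3) split[of "\<lambda>k. (w k - g k) * g k"] by simp
  qed
  then show "?l = ?r" unfolding g_def[symmetric] by (rule Ks.lsq_proj_eqI)
qed

section \<open>Least squares over convex sequences near \<open>p0\<close>\<close>

lemma summable_square_diff:
  fixes f p :: "nat \<Rightarrow> real"
  assumes "summable (\<lambda>k. (p k)^2)" "\<And>k. k > m \<Longrightarrow> f k = 0"
  shows "summable (\<lambda>k. (f k - p k)^2)"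
proof -
  have "\<forall>\<^sub>F k in sequentially. (f k - p k)^2 = (p k)^2"
    using eventually_gt_at_top[of m] by eventually_elim (simp add: assms(2))
  from summable_cong[OF this] assms(1) show ?thesis by simp
qed

text \<open>Expanding around \<open>p\<close>, the variational inequality makes the objective exceed
  its value at \<open>p\<close> by at least half the squared distance to \<open>p\<close>.
  Minimality and uniqueness follow together, which settles the definite description.\<close>

lemma lse_eqI:
  assumes p: "p \<in> Cset" and q0: "\<And>k. k > m \<Longrightarrow> q k = 0" and p0: "\<And>k. k > m \<Longrightarrow> p k = 0"
    and VI: "\<And>p'. p' \<in> Cset \<Longrightarrow> (\<Sum>k\<le>m. (q k - p k) * (p' k - p k)) \<le> 0"
  shows "lse q = p"
proof -
  have key: "summable (\<lambda>k. (p k - p' k)^2) \<and>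
      lsq_obj q p + 1/2 * (\<Sum>k. (p k - p' k)^2) \<le> lsq_obj q p'" if p': "p' \<in> Cset" for p'
  proof -
    have sp': "summable (\<lambda>k. (p' k)^2)" using p' by (simp add: Cset_def)
    have s1: "summable (\<lambda>k. (p k - p' k)^2)" by (rule summable_square_diff[OF sp' p0])
    have s2: "summable (\<lambda>k. (q k - p k)^2)"
      using p by (intro summable_square_diff[OF _ q0]) (auto simp: Cset_def)
    have fin: "finite {..m}" by simp
    have out: "2 * ((q k - p k) * (p k - p' k)) = 0" if "k \<notin> {..m}" for k
      using that q0 p0 by simp
    have s3: "summable (\<lambda>k. 2 * ((q k - p k) * (p k - p' k)))"
      by (rule summable_finite[OF fin out])
    have "(\<Sum>k. (q k - p' k)^2) = (\<Sum>k. ((q k - p k)^2 + (p k - p' k)^2) + 2 * ((q k - p k) * (p k - p' k)))"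
      by (intro suminf_cong) (simp add: power2_eq_square algebra_simps)
    also have "\<dots> = (\<Sum>k. (q k - p k)^2) + (\<Sum>k. (p k - p' k)^2) + (\<Sum>k. 2 * ((q k - p k) * (p k - p' k)))"
      using s1 s2 s3 by (simp add: suminf_add[symmetric] summable_add)
    also have "(\<Sum>k. 2 * ((q k - p k) * (p k - p' k))) = (\<Sum>k\<le>m. 2 * ((q k - p k) * (p k - p' k)))"
      by (rule suminf_finite[OF fin out])
    also have "\<dots> = - 2 * (\<Sum>k\<le>m. (q k - p k) * (p' k - p k))"
      unfolding sum_distrib_left by (intro sum.cong refl) (simp add: algebra_simps)
    finally show ?thesis using VI[OF p'] s1 by (simp add: lsq_obj_def)
  qed
  show ?thesis unfolding lse_def
  proof (rule the_equality)
    show "p \<in> Cset \<and> (\<forall>p'\<in>Cset. lsq_obj q p \<le> lsq_obj q p')"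
    proof (intro conjI ballI p)
      fix p' assume "p' \<in> Cset"
      from key[OF this] suminf_nonneg[of "\<lambda>k. (p k - p' k)^2"]
      show "lsq_obj q p \<le> lsq_obj q p'" by auto
    qed
    fix r assume r: "r \<in> Cset \<and> (\<forall>p'\<in>Cset. lsq_obj q r \<le> lsq_obj q p')"
    then have "lsq_obj q r \<le> lsq_obj q p" using p by blast
    with key[of r] r have sm: "summable (\<lambda>k. (p k - r k)^2)" and "(\<Sum>k. (p k - r k)^2) \<le> 0" by auto
    with suminf_nonneg[OF sm] have "(\<Sum>k. (p k - r k)^2) = 0" by fastforce
    with suminf_eq_zero_iff[OF sm] have "p k = r k" for k by simp
    then show "r = p" by auto
  qed
qed

text \<open>Where \<open>p\<close> is flat the candidate inherits convexity from \<open>g\<close>;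
  where it bends, the bend is at least \<open>d\<close> and outweighs the perturbation. A second
  difference of \<open>g\<close> is at most four times its largest entry, whence the bound
  \<open>d * t / 4\<close>.\<close>

lemma lse_eq_scaled_proj:
  assumes nonneg: "\<And>k. p k \<ge> 0" and beyond: "\<And>k. k > S \<Longrightarrow> p k = 0" and pS: "p S > 0"
    and conv: "convex_seq p" and q0: "\<And>k. k > S \<Longrightarrow> q k = 0" and t: "t > 0"
    and d: "\<And>k. 1 \<le> k \<Longrightarrow> k \<le> S + 1 \<Longrightarrow> Dlt p k > 0 \<Longrightarrow> Dlt p k \<ge> d" and d0: "d \<ge> 0"
    and small: "(\<Sum>k\<le>S+1. (t * (q k - p k))^2) \<le> (d * t / 4)^2"
  shows "lse q = (\<lambda>k. p k + lsq_proj (CK p S) (S + 1) (\<lambda>k. t * (q k - p k)) k / t)"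
proof -
  interpret vec_cone "CK p S" "S + 1" by (rule vec_cone_CK)
  define w where "w k = t * (q k - p k)" for k
  define g where "g = lsq_proj (CK p S) (S + 1) w"
  have g: "g \<in> CK p S" "\<And>h. h \<in> CK p S \<Longrightarrow> (\<Sum>k\<le>S+1. (w k - g k) * h k) \<le> 0"
    "(\<Sum>k\<le>S+1. (w k - g k) * g k) = 0"
    using lsq_proj_is_proj[of w] unfolding g_def is_proj_def by blast+
  have g0: "g k = 0" if "k > S + 1" for k using lsq_proj_beyond[OF that] by (simp add: g_def)
  have gS: "g (S + 1) \<ge> 0"
    using proj_CK_last_ge[of w S p] by (simp add: g_def w_def q0 beyond)
  have gb: "\<bar>g k\<bar> \<le> d * t / 4" for k
  proof (cases "k \<le> S + 1")
    case True
    \<comment> \<open>The projection fixes 0 and is a contraction, so no entry of \<open>g\<close>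
      exceeds the norm of the data.\<close>
    have "(g k)^2 \<le> (d * t / 4)^2"
      using order_trans[OF lsq_proj_coord_contraction[OF True, of w "\<lambda>_. 0"]] small
      unfolding lsq_proj_zero g_def[symmetric] w_def diff_0_right by blast
    then show ?thesis using d0 t by (simp add: abs_le_square_iff[symmetric])
  next
    case False
    then show ?thesis using g0 d0 t by simp
  qed
  define r where "r k = p k + g k / t" for k
  have rD: "Dlt r k = Dlt p k + Dlt g k / t" for k
    using t by (simp add: r_def Dlt_def field_simps)
  have "Dlt r k \<ge> 0" if k: "k \<ge> 1" for k
  proof -
    \<comment> \<open>At \<open>S + 2\<close> the second difference of the candidate is
      \<open>g (S + 1) / t\<close>; from \<open>S + 3\<close> on everything is 0.\<close>
    consider "k \<ge> S + 3" | "k = S + 2" | "k \<le> S + 1" "Dlt p k > 0" | "k \<le> S + 1" "Dlt p k = 0"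
      using conv k unfolding convex_seq_def by fastforce
    then show ?thesis
    proof cases
      case 1
      then show ?thesis by (simp add: Dlt_def r_def beyond g0)
    next
      case 2
      then show ?thesis using gS t by (simp add: Dlt_def r_def beyond g0)
    next
      case 3
      have "- Dlt g k \<le> d * t"
        using gb[of "k+1"] gb[of k] gb[of "k-1"] unfolding Dlt_def by linarith
      then have "- d \<le> Dlt g k / t" using t by (simp add: field_simps)
      then show ?thesis using d[OF k 3] by (simp add: rD)
    next
      case 4
      \<comment> \<open>Excludes \<open>S + 1\<close> from the flat case, where the cone would give
        no information.\<close>
      have "Dlt p (S + 1) > 0" using pS by (simp add: Dlt_def beyond)
      then have "k \<le> S" using 4 by (cases "k = S + 1") auto
      then have "Dlt g k \<ge> 0" using g(1) 4 k by (auto simp: CK_eq is_knot_def)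
      then show ?thesis using 4 t by (simp add: rD)
    qed
  qed
  then have rC: "convex_seq r" by (simp add: convex_seq_def)
  have r0: "r k = 0" if "k > S + 1" for k using that by (simp add: r_def beyond g0)
  have "summable (\<lambda>k. (r k)^2)"
    by (rule summable_finite[of "{..S+1}"]) (auto simp: r0)
  with rC have "r \<in> Cset" by (simp add: Cset_def)
  then have "lse q = r"
  proof (rule lse_eqI[where m = "S + 1"])
    fix p' assume p': "p' \<in> Cset"
    \<comment> \<open>Every convex competitor yields a feasible direction: away from the knots the
      second difference of \<open>p\<close> is at most 0 and that of \<open>p'\<close> is
      nonnegative.\<close>
    define h where "h k = (if k \<le> S + 1 then t * (p' k - p k) else 0)" for k
    have "Dlt h k \<ge> 0" if k: "0 < k" "k \<le> S" "\<not> is_knot p k" for k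
    proof -
      have "k - 1 \<le> S + 1" using k by simp
      then have "Dlt h k = t * (Dlt p' k - Dlt p k)" using k by (simp add: h_def Dlt_def algebra_simps)
      moreover have "Dlt p k \<le> 0" using k by (simp add: is_knot_def)
      moreover have "Dlt p' k \<ge> 0" using p' k by (simp add: Cset_def convex_seq_def)
      ultimately show ?thesis using t by simp
    qed
    then have "h \<in> CK p S" by (auto simp: CK_eq vecs_def h_def)
    from g(2)[OF this] g(3) have "(\<Sum>k\<le>S+1. (w k - g k) * (h k - g k)) \<le> 0"
      by (simp add: right_diff_distrib sum_subtractf)
    moreover have "(\<Sum>k\<le>S+1. (w k - g k) * (h k - g k)) = t^2 * (\<Sum>k\<le>S+1. (q k - r k) * (p' k - r k))"
      unfolding sum_distrib_left using t
      by (intro sum.cong refl) (simp add: w_def h_def r_def power2_eq_square field_simps)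
    ultimately show "(\<Sum>k\<le>S+1. (q k - r k) * (p' k - r k)) \<le> 0"
      using t by (simp add: mult_le_0_iff)
  qed (auto simp: q0 r0)
  then show ?thesis unfolding r_def[abs_def] g_def w_def[abs_def] .
qed

section \<open>Probability that the exact projection formula fails\<close>

context iid_sample begin

text \<open>The empirical distribution takes countably many values, so no regularity of the estimator is needed.\<close>

lemma emp_pmf_comp_measurable:
  assumes "\<And>q. H q \<in> space A"
  shows "(\<lambda>\<omega>. H (emp_pmf X n \<omega>)) \<in> measurable M A"
proof -
  define V where "V \<omega> = map (\<lambda>i. X i \<omega>) [1..<Suc n]" for \<omega>
  define E where "E l j = real (card {i\<in>{1..n}. l ! (i - 1) = j}) / real n" for l :: "nat list" and j :: nat
  have emp: "emp_pmf X n \<omega> = E (V \<omega>)" for \<omega>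
  proof
    fix j
    have "{i\<in>{1..n}. X i \<omega> = j} = {i\<in>{1..n}. V \<omega> ! (i - 1) = j}"
      by (auto simp: V_def simp del: upt_Suc)
    then show "emp_pmf X n \<omega> j = E (V \<omega>) j" by (simp add: emp_pmf_def E_def)
  qed
  have "V \<in> measurable M (count_space UNIV)"
  proof (rule measurable_count_space_eq_countable[THEN iffD2])
    show "V \<in> space M \<rightarrow> UNIV \<and> (\<forall>l\<in>UNIV. V -` {l} \<inter> space M \<in> events)"
    proof (intro conjI ballI)
      fix l
      have "V \<omega> = l \<longleftrightarrow> length l = n \<and> (\<forall>i<n. X (Suc i) \<omega> = l ! i)" for \<omega>
        unfolding list_eq_iff_nth_eq by (auto simp: V_def simp del: upt_Suc)
      then have "V -` {l} \<inter> space M = {\<omega> \<in> space M. length l = n \<and> (\<forall>i<n. X (Suc i) \<omega> = l ! i)}"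
        by auto
      also have "\<dots> \<in> events"
      proof -
        have [measurable]: "Measurable.pred M (\<lambda>\<omega>. X (Suc i) \<omega> = j)" for i j
          using X_event[of "Suc i" j] by (simp add: pred_def)
        show ?thesis by measurable
      qed
      finally show "V -` {l} \<inter> space M \<in> events" .
    qed auto
  qed auto
  moreover have "(\<lambda>l. H (E l)) \<in> measurable (count_space UNIV) A" using assms by auto
  ultimately show ?thesis unfolding emp by (rule measurable_compose)
qed

lemma emp_pmf_event: "{\<omega> \<in> space M. P (emp_pmf X n \<omega>)} \<in> events"
proof -
  have "(\<lambda>\<omega>. P (emp_pmf X n \<omega>)) \<in> measurable M (count_space UNIV)"
    by (rule emp_pmf_comp_measurable) simp
  then show ?thesis by (simp add: pred_def)
qed

lemma emp_pmf_beyond: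
  assumes "\<forall>i\<in>{1..n}. X i \<omega> \<le> S" "k > S"
  shows "emp_pmf X n \<omega> k = 0"
proof -
  have "{i\<in>{1..n}. X i \<omega> = k} = {}" using assms by fastforce
  then show ?thesis by (simp add: emp_pmf_def)
qed

text \<open>All coordinates are compared, also those beyond \<open>S + 1\<close>, so off this event
  an identity of whole sequences holds.\<close>

definition inexact :: "nat \<Rightarrow> 'a set" where
  "inexact n = {\<omega> \<in> space M. \<not> (\<forall>k. sqrt (real n) * (lse (emp_pmf X n \<omega>) k - p0 k)
     = lsq_proj (CK p0 S) (S + 1) (dev n \<omega>) k)}"

lemma inexact_event: "inexact n \<in> events"
  unfolding inexact_def dev_def[abs_def] by (rule emp_pmf_event)

lemma inexact_limit:
  assumes pS: "p0 S > 0" and conv: "convex_seq p0"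
  shows "(\<lambda>n. prob (inexact n)) \<longlonglongrightarrow> 0"
proof -
  \<comment> \<open>The minimum is a common lower bound for the positive second differences up to
    \<open>S + 1\<close>; the element 1 makes the set nonempty by construction.\<close>
  define D where "D = insert 1 (Dlt p0 ` {k \<in> {1..S+1}. Dlt p0 k > 0})"
  have D: "finite D" "D \<noteq> {}" "\<forall>x\<in>D. x > 0" by (auto simp: D_def)
  define d where "d = Min D"
  have d0: "d > 0" using D Min_in[OF D(1,2)] by (auto simp: d_def)
  have d: "Dlt p0 k \<ge> d" if "1 \<le> k" "k \<le> S + 1" "Dlt p0 k > 0" for k
    unfolding d_def by (rule Min_le[OF D(1)]) (use that in \<open>auto simp: D_def\<close>)
  define C where "C = real (Suc (S + 1)) * 16 / d^2"
  have bound: "prob (inexact n) \<le> C / real n" if n: "n \<ge> 1" for n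
  proof -
    let ?c = "(d * sqrt (real n) / 4)^2"
    have c: "?c > 0" using d0 n by simp
    \<comment> \<open>The sample stays in \<open>{0..S}\<close> only almost surely, so the inclusion
      of events holds up to a null set.\<close>
    have "AE \<omega> in M. \<forall>i\<in>{1..n}. X i \<omega> \<le> S"
      by (rule AE_finite_allI) (auto intro: AE_X_le)
    then have "AE \<omega> in M. \<omega> \<in> inexact n \<longrightarrow> \<omega> \<in> {\<omega> \<in> space M. (\<Sum>k\<le>S+1. (dev n \<omega> k)^2) \<ge> ?c}"
    proof eventually_elim
      fix \<omega> assume le: "\<forall>i\<in>{1..n}. X i \<omega> \<le> S"
      show "\<omega> \<in> inexact n \<longrightarrow> \<omega> \<in> {\<omega> \<in> space M. (\<Sum>k\<le>S+1. (dev n \<omega> k)^2) \<ge> ?c}"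
      proof (intro impI, rule ccontr)
        assume bad: "\<omega> \<in> inexact n" "\<omega> \<notin> {\<omega> \<in> space M. (\<Sum>k\<le>S+1. (dev n \<omega> k)^2) \<ge> ?c}"
        then have "\<omega> \<in> space M" by (simp add: inexact_def)
        with bad have "(\<Sum>k\<le>S+1. (dev n \<omega> k)^2) \<le> ?c" by auto
        then have "(\<Sum>k\<le>S+1. (sqrt (real n) * (emp_pmf X n \<omega> k - p0 k))^2) \<le> ?c"
          by (simp only: dev_def)
        moreover have "sqrt (real n) > 0" "d \<ge> 0" using n d0 by auto
        ultimately have "lse (emp_pmf X n \<omega>) = (\<lambda>k. p0 k + lsq_proj (CK p0 S) (S + 1)
            (\<lambda>k. sqrt (real n) * (emp_pmf X n \<omega> k - p0 k)) k / sqrt (real n))"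
          by (intro lse_eq_scaled_proj[OF nonneg beyond pS conv emp_pmf_beyond[OF le] _ d])
        then have "\<omega> \<notin> inexact n"
          using n by (simp add: inexact_def dev_def[abs_def])
        with bad show False by blast
      qed
    qed
    moreover have "{\<omega> \<in> space M. (\<Sum>k\<le>S+1. (dev n \<omega> k)^2) \<ge> ?c} \<in> events"
      unfolding dev_def by (rule emp_pmf_event)
    ultimately have "prob (inexact n) \<le> prob {\<omega> \<in> space M. (\<Sum>k\<le>S+1. (dev n \<omega> k)^2) \<ge> ?c}"
      by (rule finite_measure_mono_AE)
    also have "\<dots> \<le> real (Suc (S + 1)) / ?c" by (rule dev_sum_squares_tail[OF c])
    also have "\<dots> = C / real n"
      using d0 n by (simp add: C_def power_divide power_mult_distrib del: of_nat_Suc)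
    finally show ?thesis .
  qed
  have "(\<lambda>n. C / real n) \<longlonglongrightarrow> 0" by real_asymp
  then show ?thesis
  proof (rule Lim_null_comparison[rotated])
    show "\<forall>\<^sub>F n in sequentially. norm (prob (inexact n)) \<le> C / real n"
      using eventually_ge_at_top[of 1] by eventually_elim (use bound in auto)
  qed
qed

lemma dev_borel: "dev n \<in> borel_measurable M"
  by (rule measurable_coordinatewise_then_product) (rule dev_measurable)

lemma dev_weak_limit:
  assumes U: "brownian_bridge N U" and L: "L \<ge> S"
    and cont: "continuous_on UNIV (f :: (nat \<Rightarrow> real) \<Rightarrow> real)" and C: "\<And>x. \<bar>f x\<bar> \<le> C"
    and dep: "\<And>x y. (\<And>k. k \<le> L \<Longrightarrow> x k = y k) \<Longrightarrow> f x = f y"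
  shows "(\<lambda>n. expectation (\<lambda>\<omega>. f (dev n \<omega>))) \<longlonglongrightarrow> (\<integral>\<omega>. f (Wvec p0 (U \<omega>)) \<partial>N)"
proof (rule weak_limit_of_characteristic_limit[where L = L and f = f and C = C, OF prob_space_axioms])
  show "prob_space N" using U by (simp add: brownian_bridge_def)
  show "dev n \<in> borel_measurable M" for n by (rule dev_borel)
  show "(\<lambda>\<omega>. Wvec p0 (U \<omega>)) \<in> borel_measurable N"
    by (rule measurable_coordinatewise_then_product)
       (rule Wvec_bridge_measurable[OF U nonneg total beyond])
  show "(\<lambda>n. expectation (\<lambda>\<omega>. cos ((\<Sum>k\<le>L. a k * dev n \<omega> k) + b)))
     \<longlonglongrightarrow> (\<integral>\<omega>. cos ((\<Sum>k\<le>L. a k * Wvec p0 (U \<omega>) k) + b) \<partial>N)" for a b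
  proof -
    have "(\<integral>\<omega>. cos ((\<Sum>k\<le>L. a k * Wvec p0 (U \<omega>) k) + b) \<partial>N) = exp (- linear_var p0 L a / 2) * cos b"
      by (rule linear_bridge_expectation[OF U nonneg total beyond])
    then show ?thesis using linear_dev_limit[OF L, of a b] by simp
  qed
  show "\<exists>D. \<forall>n. prob {\<omega> \<in> space M. \<exists>k\<le>L. \<bar>dev n \<omega> k\<bar> > D} < e" if "e > 0" for e
    by (rule dev_tight[OF that])
qed (use cont C dep in blast)+

end

section \<open>Asymptotics of the estimator\<close>

lemma borel_measurable_lsq_proj:
  assumes "vec_cone K n" "Y \<in> borel_measurable Q"
  shows "(\<lambda>\<omega>. lsq_proj K n (Y \<omega>)) \<in> borel_measurable Q"
  by (rule measurable_compose[OF assms(2) borel_measurable_continuous_onI])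
     (rule vec_cone.continuous_on_lsq_proj[OF assms(1)])

text \<open>For ordered variables, equal means of a strictly increasing function force almost sure
  equality. \<open>arctan\<close> is also bounded and continuous, hence integrable and an admissible
  test function for weak convergence.\<close>

lemma arctan_expectation_eq_imp_AE_eq:
  fixes A B :: "'b \<Rightarrow> real"
  assumes N: "prob_space N" and AB: "A \<in> borel_measurable N" "B \<in> borel_measurable N"
    and le: "\<And>\<omega>. \<omega> \<in> space N \<Longrightarrow> A \<omega> \<le> B \<omega>"
    and eq: "(\<integral>\<omega>. arctan (A \<omega>) \<partial>N) = (\<integral>\<omega>. arctan (B \<omega>) \<partial>N)"
  shows "AE \<omega> in N. A \<omega> = B \<omega>"
proof -
  interpret prob_space N by fact
  have bd: "\<bar>arctan x\<bar> \<le> pi / 2" for x using arctan_bounded[of x] by linarith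
  have arct: "arctan \<in> borel_measurable borel"
    by (intro borel_measurable_continuous_onI continuous_intros)
  have int: "integrable N (\<lambda>\<omega>. arctan (Y \<omega>))" if "Y \<in> borel_measurable N" for Y
    using measurable_compose[OF that arct] bd by (intro integrable_const_bound[of _ "pi/2"]) auto
  have i: "integrable N (\<lambda>\<omega>. arctan (B \<omega>) - arctan (A \<omega>))" using int AB by auto
  have "(\<integral>\<omega>. arctan (B \<omega>) - arctan (A \<omega>) \<partial>N) = 0" using int AB eq by simp
  moreover have "AE \<omega> in N. 0 \<le> arctan (B \<omega>) - arctan (A \<omega>)"
    by (rule AE_I2) (use le in \<open>simp add: arctan_le_iff\<close>)
  ultimately have "AE \<omega> in N. arctan (B \<omega>) - arctan (A \<omega>) = 0"
    using integral_nonneg_eq_0_iff_AE[OF i] by blast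
  then show ?thesis by eventually_elim (simp add: arctan_eq_iff)
qed

context iid_sample begin

abbreviation "PK \<equiv> lsq_proj (CK p0 S) (S + 1)"

text \<open>Off \<open>inexact n\<close> the rescaled estimator is a continuous function of
  \<open>dev n\<close>, so the expectations differ by at most
  \<open>2 * C * prob (inexact n)\<close>; the limit of \<open>dev n\<close> does the rest.\<close>

lemma restricted_lse_weak_limit:
  fixes f :: "(nat \<Rightarrow> real) \<Rightarrow> real"
  assumes U: "brownian_bridge N U" and pS: "p0 S > 0" and conv: "convex_seq p0" and s: "s \<le> S"
    and f: "continuous_on UNIV f" "bounded (range f)"
  shows "(\<lambda>n. expectation (\<lambda>\<omega>. f (\<lambda>k. if k \<le> s then sqrt (real n) * (lse (emp_pmf X n \<omega>) k - p0 k) else 0)))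
     \<longlonglongrightarrow> (\<integral>\<omega>. f (\<lambda>k. if k \<le> s then PK (Wvec p0 (U \<omega>)) k else 0) \<partial>N)"
proof -
  interpret K: vec_cone "CK p0 S" "S + 1" by (rule vec_cone_CK)
  obtain C where C: "\<And>x. \<bar>f x\<bar> \<le> C" using f(2) by (auto simp: bounded_iff)
  define Y where "Y n \<omega> k = (if k \<le> s then sqrt (real n) * (lse (emp_pmf X n \<omega>) k - p0 k) else 0)" for n \<omega> k
  define g where "g x = f (\<lambda>k. if k \<le> s then PK x k else 0)" for x
  have contPK: "continuous_on UNIV (\<lambda>x. PK x k)" for k
    by (rule continuous_on_product_then_coordinatewise[OF K.continuous_on_lsq_proj])
  have "continuous_on UNIV (\<lambda>x k. if k \<le> s then PK x k else 0)"
  proof (rule continuous_on_coordinatewise_then_product)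
    show "continuous_on UNIV (\<lambda>x. if k \<le> s then PK x k else 0)" for k
      using contPK by (cases "k \<le> s") auto
  qed
  then have gc: "continuous_on UNIV g"
    unfolding g_def[abs_def] by (rule continuous_on_compose2[OF f(1)]) auto
  have gb: "\<bar>g x\<bar> \<le> C" for x using C by (simp add: g_def)
  have gdep: "g x = g y" if "\<And>k. k \<le> S + 1 \<Longrightarrow> x k = y k" for x y
    using K.lsq_proj_cong[of x y, OF that] by (simp only: g_def)
  have lim: "(\<lambda>n. expectation (\<lambda>\<omega>. g (dev n \<omega>))) \<longlonglongrightarrow> (\<integral>\<omega>. g (Wvec p0 (U \<omega>)) \<partial>N)"
    by (rule dev_weak_limit[OF U _ gc gb gdep, of "S + 1"]) auto
  have fm: "f \<in> borel_measurable borel" by (rule borel_measurable_continuous_onI[OF f(1)])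
  have Ym: "(\<lambda>\<omega>. f (Y n \<omega>)) \<in> borel_measurable M" for n
    unfolding Y_def[abs_def] by (rule emp_pmf_comp_measurable) simp
  have Yi: "integrable M (\<lambda>\<omega>. f (Y n \<omega>))" for n
    by (rule integrable_const_bound[of _ C]) (use C Ym in auto)
  have gi: "integrable M (\<lambda>\<omega>. g (dev n \<omega>))" for n
    by (rule integrable_bounded_continuous[OF prob_space_axioms dev_borel gc gb])
  have ii: "integrable M (indicat_real (inexact n))" for n
    using inexact_event by (simp add: emeasure_finite less_top[symmetric])
  have near: "\<bar>expectation (\<lambda>\<omega>. f (Y n \<omega>)) - expectation (\<lambda>\<omega>. g (dev n \<omega>))\<bar> \<le> 2 * C * prob (inexact n)" for n
  proof -
    have "\<bar>\<integral>\<omega>. f (Y n \<omega>) - g (dev n \<omega>) \<partial>M\<bar> \<le> (\<integral>\<omega>. \<bar>f (Y n \<omega>) - g (dev n \<omega>)\<bar> \<partial>M)"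
      by (rule integral_abs_bound)
    also have "\<dots> \<le> (\<integral>\<omega>. 2 * C * indicat_real (inexact n) \<omega> \<partial>M)"
    proof (rule integral_mono)
      show "\<bar>f (Y n \<omega>) - g (dev n \<omega>)\<bar> \<le> 2 * C * indicat_real (inexact n) \<omega>" if "\<omega> \<in> space M" for \<omega>
      proof (cases "\<omega> \<in> inexact n")
        case True
        then show ?thesis using C[of "Y n \<omega>"] gb[of "dev n \<omega>"] by simp
      next
        case False
        then have "Y n \<omega> = (\<lambda>k. if k \<le> s then PK (dev n \<omega>) k else 0)"
          using that by (auto simp: inexact_def Y_def)
        then show ?thesis using False by (simp add: g_def)
      qed
    qed (use Yi gi ii in auto)
    also have "\<dots> = 2 * C * prob (inexact n)" using ii inexact_event by simp
    finally show ?thesis using Yi gi by simp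
  qed
  have "(\<lambda>n. expectation (\<lambda>\<omega>. f (Y n \<omega>)) - expectation (\<lambda>\<omega>. g (dev n \<omega>))) \<longlonglongrightarrow> 0"
  proof (rule Lim_null_comparison)
    show "\<forall>\<^sub>F n in sequentially. norm (expectation (\<lambda>\<omega>. f (Y n \<omega>)) - expectation (\<lambda>\<omega>. g (dev n \<omega>)))
        \<le> 2 * C * prob (inexact n)"
      using near by simp
    show "(\<lambda>n. 2 * C * prob (inexact n)) \<longlonglongrightarrow> 0"
      using tendsto_mult_right_zero[OF inexact_limit[OF pS conv]] by simp
  qed
  from tendsto_add[OF this lim] show ?thesis by (simp add: Y_def[abs_def] g_def)
qed

text \<open>Convergence in probability to 0 is measured by the mean of
  \<open>min 1 \<bar>d\<bar>\<close>, a bounded continuous function of \<open>dev n\<close>. Its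
  limit under the bridge is 0 exactly when the limiting gap vanishes almost surely.\<close>

lemma cumulative_gap_limit_iff:
  assumes U: "brownian_bridge N U" and pS: "p0 S > 0" and conv: "convex_seq p0" and s: "s \<le> S"
  shows "(\<forall>\<epsilon>>0. (\<lambda>n. prob {\<omega> \<in> space M.
       \<bar>sqrt (real n) * (Fseq (lse (emp_pmf X n \<omega>)) s - Fseq (emp_pmf X n \<omega>) s)\<bar> > \<epsilon>}) \<longlonglongrightarrow> 0)
    \<longleftrightarrow> (AE \<omega> in N. (\<Sum>k\<le>s. PK (Wvec p0 (U \<omega>)) k) = (\<Sum>k\<le>s. Wvec p0 (U \<omega>) k))"
proof -
  interpret K: vec_cone "CK p0 S" "S + 1" by (rule vec_cone_CK)
  interpret N: prob_space N using U by (simp add: brownian_bridge_def)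
  define gap where "gap n \<omega> = sqrt (real n) * (Fseq (lse (emp_pmf X n \<omega>)) s - Fseq (emp_pmf X n \<omega>) s)" for n \<omega>
  define d where "d x = (\<Sum>k\<le>s. PK x k) - (\<Sum>k\<le>s. x k)" for x :: "nat \<Rightarrow> real"
  define \<phi> where "\<phi> x = min 1 \<bar>d x\<bar>" for x
  have contPK: "continuous_on UNIV (\<lambda>x. PK x k)" for k
    by (rule continuous_on_product_then_coordinatewise[OF K.continuous_on_lsq_proj])
  have \<phi>c: "continuous_on UNIV \<phi>"
    unfolding \<phi>_def[abs_def] d_def
    by (intro continuous_intros contPK continuous_on_product_coordinates)
  have \<phi>b: "\<bar>\<phi> x\<bar> \<le> 1" for x by (simp add: \<phi>_def)
  have \<phi>0: "0 \<le> \<phi> x" for x by (simp add: \<phi>_def)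
  have \<phi>dep: "\<phi> x = \<phi> y" if "\<And>k. k \<le> S + 1 \<Longrightarrow> x k = y k" for x y
    using K.lsq_proj_cong[of x y] that s by (simp add: \<phi>_def d_def)
  have lim: "(\<lambda>n. expectation (\<lambda>\<omega>. \<phi> (dev n \<omega>))) \<longlonglongrightarrow> (\<integral>\<omega>. \<phi> (Wvec p0 (U \<omega>)) \<partial>N)"
    by (rule dev_weak_limit[OF U _ \<phi>c \<phi>b \<phi>dep, of "S + 1"]) auto
  have Wb: "(\<lambda>\<omega>. Wvec p0 (U \<omega>)) \<in> borel_measurable N"
    by (rule measurable_coordinatewise_then_product)
       (rule Wvec_bridge_measurable[OF U nonneg total beyond])
  have \<phi>iM: "integrable M (\<lambda>\<omega>. \<phi> (dev n \<omega>))" for n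
    by (rule integrable_bounded_continuous[OF prob_space_axioms dev_borel \<phi>c \<phi>b])
  have \<phi>iN: "integrable N (\<lambda>\<omega>. \<phi> (Wvec p0 (U \<omega>)))"
    by (rule integrable_bounded_continuous[OF N.prob_space_axioms Wb \<phi>c \<phi>b])
  have gap_d: "gap n \<omega> = d (dev n \<omega>)" if "\<omega> \<in> space M" "\<omega> \<notin> inexact n" for n \<omega>
  proof -
    have "PK (dev n \<omega>) k = sqrt (real n) * (lse (emp_pmf X n \<omega>) k - p0 k)" for k
      using that by (simp add: inexact_def)
    then have diff: "PK (dev n \<omega>) k - dev n \<omega> k = sqrt (real n) * (lse (emp_pmf X n \<omega>) k - emp_pmf X n \<omega> k)" for k
      by (simp add: dev_def right_diff_distrib)
    have "d (dev n \<omega>) = (\<Sum>k\<le>s. PK (dev n \<omega>) k - dev n \<omega> k)" by (simp only: d_def sum_subtractf)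
    also have "\<dots> = gap n \<omega>"
      unfolding diff gap_def Fseq_def by (simp only: sum_distrib_left[symmetric] sum_subtractf)
    finally show ?thesis by simp
  qed
  have gap_ev: "{\<omega> \<in> space M. \<bar>gap n \<omega>\<bar> > e} \<in> events" for n e
    unfolding gap_def by (rule emp_pmf_event)
  have AE_iff: "(\<integral>\<omega>. \<phi> (Wvec p0 (U \<omega>)) \<partial>N) = 0 \<longleftrightarrow>
     (AE \<omega> in N. (\<Sum>k\<le>s. PK (Wvec p0 (U \<omega>)) k) = (\<Sum>k\<le>s. Wvec p0 (U \<omega>) k))"
  proof -
    have "\<phi> x = 0 \<longleftrightarrow> (\<Sum>k\<le>s. PK x k) = (\<Sum>k\<le>s. x k)" for x
      by (auto simp: \<phi>_def d_def min_def)
    then show ?thesis using integral_nonneg_eq_0_iff_AE[OF \<phi>iN] \<phi>0 by simp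
  qed
  have "(\<forall>\<epsilon>>0. (\<lambda>n. prob {\<omega> \<in> space M. \<bar>gap n \<omega>\<bar> > \<epsilon>}) \<longlonglongrightarrow> 0) \<longleftrightarrow> (\<integral>\<omega>. \<phi> (Wvec p0 (U \<omega>)) \<partial>N) = 0"
  proof
    assume small: "\<forall>\<epsilon>>0. (\<lambda>n. prob {\<omega> \<in> space M. \<bar>gap n \<omega>\<bar> > \<epsilon>}) \<longlonglongrightarrow> 0"
    have "(\<integral>\<omega>. \<phi> (Wvec p0 (U \<omega>)) \<partial>N) \<le> e" if e: "e > 0" for e
    proof -
      \<comment> \<open>The cap at 1 pays for the two exceptional events; elsewhere
        \<open>\<phi>\<close> is at most \<open>e\<close>.\<close>
      have le: "expectation (\<lambda>\<omega>. \<phi> (dev n \<omega>)) \<le> e + prob {\<omega> \<in> space M. \<bar>gap n \<omega>\<bar> > e} + prob (inexact n)" for n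
      proof -
        let ?G = "{\<omega> \<in> space M. \<bar>gap n \<omega>\<bar> > e}"
        have i: "integrable M (indicat_real ?G)" "integrable M (indicat_real (inexact n))"
          using inexact_event gap_ev by (auto simp: emeasure_finite less_top[symmetric])
        have "expectation (\<lambda>\<omega>. \<phi> (dev n \<omega>)) \<le> (\<integral>\<omega>. e + indicat_real ?G \<omega> + indicat_real (inexact n) \<omega> \<partial>M)"
        proof (rule integral_mono)
          show "\<phi> (dev n \<omega>) \<le> e + indicat_real ?G \<omega> + indicat_real (inexact n) \<omega>" if "\<omega> \<in> space M" for \<omega>
          proof (cases "\<omega> \<in> inexact n \<or> \<omega> \<in> ?G")
            case True
            moreover have "\<phi> (dev n \<omega>) \<le> 1" using \<phi>b[of "dev n \<omega>"] by simp
            ultimately show ?thesis using e by (auto simp: indicator_def)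
          next
            case False
            then have "\<bar>d (dev n \<omega>)\<bar> \<le> e" using gap_d[OF that] that by auto
            then show ?thesis using False by (simp add: \<phi>_def)
          qed
        qed (use \<phi>iM i in auto)
        also have "\<dots> = e + prob ?G + prob (inexact n)"
          using i gap_ev inexact_event by (simp add: prob_space)
        finally show ?thesis .
      qed
      have "(\<lambda>n. e + prob {\<omega> \<in> space M. \<bar>gap n \<omega>\<bar> > e} + prob (inexact n)) \<longlonglongrightarrow> e + 0 + 0"
        using small e by (intro tendsto_add tendsto_const inexact_limit[OF pS conv]) auto
      from LIMSEQ_le[OF lim this] le show ?thesis by auto
    qed
    then have "(\<integral>\<omega>. \<phi> (Wvec p0 (U \<omega>)) \<partial>N) \<le> 0" by (rule field_le_epsilon[of _ 0, simplified])
    moreover have "(\<integral>\<omega>. \<phi> (Wvec p0 (U \<omega>)) \<partial>N) \<ge> 0" using \<phi>0 by simp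
    ultimately show "(\<integral>\<omega>. \<phi> (Wvec p0 (U \<omega>)) \<partial>N) = 0" by simp
  next
    assume zero: "(\<integral>\<omega>. \<phi> (Wvec p0 (U \<omega>)) \<partial>N) = 0"
    show "\<forall>\<epsilon>>0. (\<lambda>n. prob {\<omega> \<in> space M. \<bar>gap n \<omega>\<bar> > \<epsilon>}) \<longlonglongrightarrow> 0"
    proof (intro allI impI)
      fix e :: real assume e: "e > 0"
      \<comment> \<open>\<open>\<phi>\<close> saturates at 1, so a threshold above 1 has to be
        lowered before Markov's inequality is applied.\<close>
      define c where "c = min 1 e"
      have c: "c > 0" using e by (simp add: c_def)
      have \<phi>ev: "{\<omega> \<in> space M. \<phi> (dev n \<omega>) \<ge> c} \<in> events" for n
        unfolding dev_def[abs_def] by (rule emp_pmf_event)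
      have le: "prob {\<omega> \<in> space M. \<bar>gap n \<omega>\<bar> > e} \<le> prob (inexact n) + expectation (\<lambda>\<omega>. \<phi> (dev n \<omega>)) / c" for n
      proof -
        have "prob {\<omega> \<in> space M. \<bar>gap n \<omega>\<bar> > e} \<le> prob (inexact n \<union> {\<omega> \<in> space M. \<phi> (dev n \<omega>) \<ge> c})"
        proof (rule finite_measure_mono)
          show "{\<omega> \<in> space M. \<bar>gap n \<omega>\<bar> > e} \<subseteq> inexact n \<union> {\<omega> \<in> space M. \<phi> (dev n \<omega>) \<ge> c}"
            using gap_d by (auto simp: \<phi>_def c_def)
        qed (use \<phi>ev inexact_event in auto)
        also have "\<dots> \<le> prob (inexact n) + prob {\<omega> \<in> space M. \<phi> (dev n \<omega>) \<ge> c}"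
          by (rule measure_Un_le) (use \<phi>ev inexact_event in auto)
        also have "prob {\<omega> \<in> space M. \<phi> (dev n \<omega>) \<ge> c} \<le> expectation (\<lambda>\<omega>. \<phi> (dev n \<omega>)) / c"
          by (rule integral_Markov_inequality_measure[where A = "{}"]) (use \<phi>iM \<phi>0 c in auto)
        finally show ?thesis by simp
      qed
      have "(\<lambda>n. prob (inexact n) + expectation (\<lambda>\<omega>. \<phi> (dev n \<omega>)) / c) \<longlonglongrightarrow> 0 + 0 / c"
        using lim c zero by (intro tendsto_intros inexact_limit[OF pS conv]) auto
      then have "(\<lambda>n. prob (inexact n) + expectation (\<lambda>\<omega>. \<phi> (dev n \<omega>)) / c) \<longlonglongrightarrow> 0" by simp
      then show "(\<lambda>n. prob {\<omega> \<in> space M. \<bar>gap n \<omega>\<bar> > e}) \<longlonglongrightarrow> 0"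
        by (rule Lim_null_comparison[rotated]) (use le in auto)
    qed
  qed
  then show ?thesis unfolding AE_iff gap_def .
qed

end

theorem theorem4:
  fixes p0 :: "nat \<Rightarrow> real" and S s :: nat
    and M :: "'a measure" and X :: "nat \<Rightarrow> 'a \<Rightarrow> nat"
    and N :: "'b measure" and U :: "'b \<Rightarrow> real \<Rightarrow> real"
  assumes p0_nonneg: "\<forall>k. p0 k \<ge> 0"
    and p0_sum: "(\<Sum>k\<le>S. p0 k) = 1"
    and p0_supp: "{k. p0 k \<noteq> 0} = {..S}"
    and S_ge: "S \<ge> 1"
    and p0_convex: "convex_seq p0"
    and m_ge: "{k. 1 \<le> k \<and> k \<le> S \<and> is_knot p0 k} \<noteq> {}"
    and M_prob: "prob_space M"
    and X_indep: "prob_space.indep_vars M (\<lambda>_. count_space UNIV) X {1..}"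
    and X_distr: "\<forall>i\<ge>1. \<forall>j. measure M {\<omega> \<in> space M. X i \<omega> = j} = p0 j"
    and U_bb: "brownian_bridge N U"
    and s_knot: "1 \<le> s" "s \<le> S" "is_knot p0 s"
  shows "(\<forall>\<omega>\<in>space N.
            (\<exists>!g. g \<in> CKle p0 S s \<and> (\<forall>h\<in>CKle p0 S s. Phi_le p0 (U \<omega>) s g \<le> Phi_le p0 (U \<omega>) s h)) \<and>
            (gle p0 S s (U \<omega>) = (\<lambda>k. if k \<le> s then ghat p0 S (U \<omega>) k else 0)
               \<longleftrightarrow> (\<Sum>k\<le>s. ghat p0 S (U \<omega>) k) = U \<omega> (Fseq p0 s)))
       \<and> (conv_distr M
             (\<lambda>n \<omega>. \<lambda>k. if k \<le> s then sqrt (real n) * (lse (emp_pmf X n \<omega>) k - p0 k) else 0)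
             N (\<lambda>\<omega>. gle p0 S s (U \<omega>))
          \<longleftrightarrow> (\<forall>\<epsilon>>0. (\<lambda>n. measure M {\<omega> \<in> space M.
                 \<bar>sqrt (real n) * (Fseq (lse (emp_pmf X n \<omega>)) s - Fseq (emp_pmf X n \<omega>) s)\<bar> > \<epsilon>})
                 \<longlonglongrightarrow> 0))"
proof -
  have pos: "p0 k \<noteq> 0 \<longleftrightarrow> k \<le> S" for k using p0_supp by auto
  have pS: "p0 S > 0" using pos[of S] p0_nonneg by (metis le_refl less_eq_real_def)
  interpret M: prob_space M by (rule M_prob)
  interpret iid_sample M X p0 S
    using p0_nonneg p0_sum pos X_indep X_distr by unfold_locales (auto simp: not_le[symmetric])
  interpret N: prob_space N using U_bb by (simp add: brownian_bridge_def)
  interpret K: vec_cone "CK p0 S" "S + 1" by (rule vec_cone_CK)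
  interpret Ks: vec_cone "CKle p0 S s" s by (rule vec_cone_CKle[OF s_knot(2,3)])
  have U0: "U \<omega> 0 = 0" if "\<omega> \<in> space N" for \<omega> using U_bb that by (simp add: brownian_bridge_def)
  have sumW: "(\<Sum>k\<le>s. Wvec p0 (U \<omega>) k) = U \<omega> (Fseq p0 s)" if "\<omega> \<in> space N" for \<omega>
    using sum_Wvec U0[OF that] by blast
  have unique: "\<exists>!g. g \<in> CKle p0 S s \<and> (\<forall>h\<in>CKle p0 S s. Phi_le p0 u s g \<le> Phi_le p0 u s h)" for u
    unfolding Phi_le_def by (rule Ks.minimizer_unique_exists)
  have restr: "gle p0 S s (U \<omega>) = (\<lambda>k. if k \<le> s then ghat p0 S (U \<omega>) k else 0)
      \<longleftrightarrow> (\<Sum>k\<le>s. ghat p0 S (U \<omega>) k) = U \<omega> (Fseq p0 s)" if "\<omega> \<in> space N" for \<omega>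
    unfolding gle_eq ghat_eq sumW[OF that, symmetric] by (rule restriction_eq_proj_iff[OF s_knot(2,3)])
  let ?Y = "\<lambda>n \<omega>. \<lambda>k. if k \<le> s then sqrt (real n) * (lse (emp_pmf X n \<omega>) k - p0 k) else 0"
  let ?R = "\<lambda>\<omega>. \<lambda>k. if k \<le> s then ghat p0 S (U \<omega>) k else 0"
  have Ym: "?Y n \<in> borel_measurable M" for n by (rule emp_pmf_comp_measurable) simp
  have Wb: "(\<lambda>\<omega>. Wvec p0 (U \<omega>)) \<in> borel_measurable N"
    by (rule measurable_coordinatewise_then_product)
       (rule Wvec_bridge_measurable[OF U_bb nonneg total beyond])
  have gm: "(\<lambda>\<omega>. gle p0 S s (U \<omega>)) \<in> borel_measurable N"
    unfolding gle_eq by (rule borel_measurable_lsq_proj[OF Ks.vec_cone_axioms Wb])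
  have hm: "(\<lambda>\<omega>. ghat p0 S (U \<omega>)) \<in> borel_measurable N"
    unfolding ghat_eq by (rule borel_measurable_lsq_proj[OF K.vec_cone_axioms Wb])
  have coord: "(\<lambda>\<omega>. g \<omega> k) \<in> borel_measurable N" if "g \<in> borel_measurable N"
    for g :: "'b \<Rightarrow> nat \<Rightarrow> real" and k
    using that by (rule measurable_compose[OF _ borel_measurable_continuous_onI]) simp
  \<comment> \<open>The rescaled estimator always converges to the restriction of
    \<open>ghat\<close>, so the question is whether \<open>?R\<close> and \<open>gle\<close> have
    the same law.\<close>
  have lim: "(\<lambda>n. \<integral>\<omega>. f (?Y n \<omega>) \<partial>M) \<longlonglongrightarrow> (\<integral>\<omega>. f (?R \<omega>) \<partial>N)"
    if "continuous_on UNIV f" "bounded (range f)" for f :: "(nat \<Rightarrow> real) \<Rightarrow> real"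
    using restricted_lse_weak_limit[OF U_bb pS p0_convex s_knot(2) that] by (simp only: ghat_eq)
  have "conv_distr M ?Y N (\<lambda>\<omega>. gle p0 S s (U \<omega>)) \<longleftrightarrow>
     (AE \<omega> in N. (\<Sum>k\<le>s. ghat p0 S (U \<omega>) k) = (\<Sum>k\<le>s. Wvec p0 (U \<omega>) k))"
  proof
    assume cd: "conv_distr M ?Y N (\<lambda>\<omega>. gle p0 S s (U \<omega>))"
    \<comment> \<open>One test function suffices: the mass of \<open>gle\<close> up to
      \<open>s\<close> equals that of the increments, and the mass of \<open>ghat\<close> is never
      smaller.\<close>
    define f where "f x = arctan (\<Sum>k\<le>s. x k)" for x :: "nat \<Rightarrow> real"
    have fc: "continuous_on UNIV f"
      unfolding f_def[abs_def] by (intro continuous_intros continuous_on_product_coordinates)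
    have "\<bar>f x\<bar> \<le> pi / 2" for x
      using arctan_bounded[of "\<Sum>k\<le>s. x k"] unfolding f_def by linarith
    then have fb: "bounded (range f)"
      unfolding bounded_iff by (intro exI[of _ "pi / 2"]) auto
    have "(\<integral>\<omega>. f (gle p0 S s (U \<omega>)) \<partial>N) = (\<integral>\<omega>. f (?R \<omega>) \<partial>N)"
      using cd fc fb by (intro LIMSEQ_unique[OF _ lim[OF fc fb]]) (auto simp: conv_distr_def)
    then have "(\<integral>\<omega>. arctan (\<Sum>k\<le>s. Wvec p0 (U \<omega>) k) \<partial>N) = (\<integral>\<omega>. arctan (\<Sum>k\<le>s. ghat p0 S (U \<omega>) k) \<partial>N)"
      by (simp add: f_def gle_eq proj_CKle_total[OF s_knot(2,3)])
    then have "AE \<omega> in N. (\<Sum>k\<le>s. Wvec p0 (U \<omega>) k) = (\<Sum>k\<le>s. ghat p0 S (U \<omega>) k)"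
    proof (rule arctan_expectation_eq_imp_AE_eq[OF N.prob_space_axioms, rotated 3])
      show "(\<Sum>k\<le>s. Wvec p0 (U \<omega>) k) \<le> (\<Sum>k\<le>s. ghat p0 S (U \<omega>) k)" for \<omega>
        unfolding ghat_eq by (rule proj_CK_sum_ge[OF s_knot(2,3)])
    qed (use coord[OF Wb] coord[OF hm] in auto)
    then show "AE \<omega> in N. (\<Sum>k\<le>s. ghat p0 S (U \<omega>) k) = (\<Sum>k\<le>s. Wvec p0 (U \<omega>) k)"
      by eventually_elim simp
  next
    assume ae: "AE \<omega> in N. (\<Sum>k\<le>s. ghat p0 S (U \<omega>) k) = (\<Sum>k\<le>s. Wvec p0 (U \<omega>) k)"
    \<comment> \<open>The pathwise criterion turns equality of masses into equality of the
      vectors.\<close>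
    then have ae': "AE \<omega> in N. gle p0 S s (U \<omega>) = ?R \<omega>"
      using AE_space by eventually_elim (simp add: restr sumW)
    have Rm: "?R \<in> borel_measurable N"
    proof (rule measurable_coordinatewise_then_product)
      show "(\<lambda>\<omega>. if k \<le> s then ghat p0 S (U \<omega>) k else 0) \<in> borel_measurable N" for k
        using coord[OF hm] by (cases "k \<le> s") auto
    qed
    have "(\<integral>\<omega>. f (gle p0 S s (U \<omega>)) \<partial>N) = (\<integral>\<omega>. f (?R \<omega>) \<partial>N)"
      if f: "continuous_on UNIV f" for f :: "(nat \<Rightarrow> real) \<Rightarrow> real"
    proof (rule integral_cong_AE)
      show "(\<lambda>\<omega>. f (gle p0 S s (U \<omega>))) \<in> borel_measurable N"
        by (rule measurable_compose[OF gm borel_measurable_continuous_onI[OF f]])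
      show "(\<lambda>\<omega>. f (?R \<omega>)) \<in> borel_measurable N"
        by (rule measurable_compose[OF Rm borel_measurable_continuous_onI[OF f]])
      show "AE \<omega> in N. f (gle p0 S s (U \<omega>)) = f (?R \<omega>)"
        using ae' by eventually_elim simp
    qed
    with lim Ym gm show "conv_distr M ?Y N (\<lambda>\<omega>. gle p0 S s (U \<omega>))"
      by (simp add: conv_distr_def)
  qed
  also have "\<dots> \<longleftrightarrow> (\<forall>\<epsilon>>0. (\<lambda>n. measure M {\<omega> \<in> space M.
       \<bar>sqrt (real n) * (Fseq (lse (emp_pmf X n \<omega>)) s - Fseq (emp_pmf X n \<omega>) s)\<bar> > \<epsilon>}) \<longlonglongrightarrow> 0)"
    unfolding cumulative_gap_limit_iff[OF U_bb pS p0_convex s_knot(2)] ghat_eq ..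
  finally show ?thesis using unique restr by blast
qed

end
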